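(* Let $k\ge 3$ be an integer and let $F$ be a graph with chromatic number $\chi(F)=k+1$. For every $\varepsilon>0$ there exist $\sigma>0$ and $n_0$ such that every $F$-free graph $G$ on $n\ge n_0$ vertices with \[ q(G)\ge 2\left(1-\frac{1}{k}-\sigma\right)n \] can be obtained from $T_{n,k}$ by adding and deleting at most $\varepsilon n^2$ edges.
   Context: All graphs are finite and simple. A graph is $F$-free if it contains no subgraph isomorphic to $F$. $q(G)$ denotes the largest eigenvalue of the signless Laplacian $Q(G)=D(G)+A(G)$. $T_{n,k}$ is the complete $k$-partite graph on $n$ vertices with part sizes differing by at most one. "$G$ can be obtained from $T_{n,k}$ by adding and deleting at most $\varepsilon n^2$ edges" means that the vertex set of $G$ can be identified with that of $T_{n,k}$ so that the symmetric difference of the two edge sets has at most $\varepsilon n^2$ elements. *)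

theory Defs
  imports Main "Jordan_Normal_Form.Char_Poly"
begin

definition simple_graph :: "nat \<Rightarrow> nat set set \<Rightarrow> bool" where
  "simple_graph n E \<longleftrightarrow> (\<forall>e\<in>E. \<exists>u v. e = {u, v} \<and> u \<noteq> v \<and> u < n \<and> v < n)"

definition proper_colouring :: "nat \<Rightarrow> nat set set \<Rightarrow> nat \<Rightarrow> (nat \<Rightarrow> nat) \<Rightarrow> bool" where
  "proper_colouring n E c f \<longleftrightarrow> (\<forall>v<n. f v < c) \<and> (\<forall>u v. {u, v} \<in> E \<longrightarrow> f u \<noteq> f v)"

definition chromatic_number :: "nat \<Rightarrow> nat set set \<Rightarrow> nat" where
  "chromatic_number n E = (LEAST c. \<exists>f. proper_colouring n E c f)"

definition contains_subgraph :: "nat \<Rightarrow> nat set set \<Rightarrow> nat \<Rightarrow> nat set set \<Rightarrow> bool" where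
  "contains_subgraph n E m EF \<longleftrightarrow>
     (\<exists>\<phi>. inj_on \<phi> {..<m} \<and> \<phi> ` {..<m} \<subseteq> {..<n} \<and> (\<forall>e\<in>EF. \<phi> ` e \<in> E))"

definition F_free :: "nat \<Rightarrow> nat set set \<Rightarrow> nat \<Rightarrow> nat set set \<Rightarrow> bool" where
  "F_free n E m EF \<longleftrightarrow> \<not> contains_subgraph n E m EF"

definition degree :: "nat set set \<Rightarrow> nat \<Rightarrow> nat" where
  "degree E v = card {u. {u, v} \<in> E}"

definition signless_laplacian :: "nat \<Rightarrow> nat set set \<Rightarrow> real mat" where
  "signless_laplacian n E = mat n n (\<lambda>(i, j).
      if i = j then real (degree E i) else if {i, j} \<in> E then 1 else 0)"

text \<open>Largest eigenvalue of the signless Laplacian (real symmetric, so all eigenvalues are real).\<close>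
definition q_index :: "nat \<Rightarrow> nat set set \<Rightarrow> real" where
  "q_index n E = Max {x. eigenvalue (signless_laplacian n E) x}"

text \<open>Turan graph T_{n,k}: vertex i lies in part (i mod k); part sizes differ by at most one.\<close>
definition turan_edges :: "nat \<Rightarrow> nat \<Rightarrow> nat set set" where
  "turan_edges n k = {{i, j} | i j. i < n \<and> j < n \<and> i mod k \<noteq> j mod k}"

definition close_to_turan :: "nat \<Rightarrow> nat \<Rightarrow> nat set set \<Rightarrow> real \<Rightarrow> bool" where
  "close_to_turan n k E d \<longleftrightarrow>
     (\<exists>\<pi>. bij_betw \<pi> {..<n} {..<n} \<and>
        real (card ((E - (\<lambda>e. \<pi> ` e) ` turan_edges n k) \<union> ((\<lambda>e. \<pi> ` e) ` turan_edges n k - E))) \<le> d)"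

end

theory Submission
  imports Defs "Jordan_Normal_Form.Spectral_Radius"
begin

text \<open>
  An \<open>F\<close>-free graph has few cliques of size \<open>k + 1\<close>, since many of them would contain a complete
  \<open>(k + 1)\<close>-partite graph with large parts, hence \<open>F\<close>. So a clique grown greedily by choosing each
  vertex among those of almost largest score in the common neighbourhood of the previous ones can be made to stop
  after at most \<open>k\<close> steps, and its non-neighbourhoods partition almost all vertices into at most \<open>k\<close> parts.

  First score: an eigenvector \<open>x\<close> for \<open>q = q(G)\<close>. A chosen vertex \<open>w\<close> with part \<open>P\<close> has no neighbour
  in \<open>P\<close> and almost maximises \<open>x\<close> there, so the eigenvalue equation at \<open>w\<close> gives
  \<open>x(P) \<le> |P| x(V) / (q - n + 2|P|)\<close> up to a small error. For \<open>k \<ge> 3\<close> one has \<open>q > n\<close>, the right-hand side is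
  strictly concave in \<open>|P|\<close>, and summing over the parts forces all of them to be balanced and \<open>x\<close> to be
  nearly constant; hence \<open>G\<close> has almost \<open>(1 - 1/k) n\<^sup>2 / 2\<close> edges.

  Second score: the degree within the current common neighbourhood. As in Erdos's degree majorisation
  proof of Turan's theorem and Furedi's proof of stability, the number of edges of \<open>G\<close> plus the number of edges
  inside the parts is then at most the number of edges of the complete multipartite graph on the parts, up to a
  small error.
\<close>

section \<open>Complete multipartite subgraphs\<close>

lemma inj_on_shift_mod: "inj_on (\<lambda>j::nat. (j + i) mod n) {..<n}"
proof (rule linorder_inj_onI)
  fix a b :: nat assume ab: "a < b" "a \<in> {..<n}" "b \<in> {..<n}"
  then have "\<not> n dvd (b + i) - (a + i)" by (simp add: nat_dvd_not_less)
  then show "(a + i) mod n \<noteq> (b + i) mod n"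
    using mod_eq_dvd_iff_nat[of "a + i" "b + i" n] ab by auto
qed auto

lemma card_shift_mod_preimage:
  fixes n :: nat
  assumes "D \<subseteq> {..<n}"
  shows "card {j. j < n \<and> (j + i) mod n \<in> D} = card D"
proof -
  let ?f = "\<lambda>j. (j + i) mod n"
  have "?f ` {..<n} \<subseteq> {..<n}" by (cases "n = 0") auto
  then have "?f ` {..<n} = {..<n}"
    by (intro endo_inj_surj inj_on_shift_mod) auto
  then have "d \<in> ?f ` {j. j < n \<and> ?f j \<in> D}" if "d \<in> D" for d
  proof -
    have "d \<in> ?f ` {..<n}" using \<open>?f ` {..<n} = {..<n}\<close> assms that by blast
    with that show ?thesis by blast
  qed
  then have "?f ` {j. j < n \<and> ?f j \<in> D} = D" by blast
  moreover have "inj_on ?f {j. j < n \<and> ?f j \<in> D}"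
    by (rule inj_on_subset[OF inj_on_shift_mod]) auto
  ultimately show ?thesis using card_image[of ?f "{j. j < n \<and> ?f j \<in> D}"] by simp
qed

text \<open>Double counting: for a fixed offset \<open>i\<close> the cyclic shift by
  \<open>i\<close> is a permutation, so \<open>i\<close> contributes exactly \<open>card D\<close>
  starting points.\<close>

lemma sum_card_windows:
  fixes n :: nat
  assumes "D \<subseteq> {..<n}"
  shows "(\<Sum>j<n. card {i. i < M \<and> (j + i) mod n \<in> D}) = M * card D"
proof -
  have card_bool: "card {i. i < N \<and> R i} = (\<Sum>i<N. of_bool (R i))" for N :: nat and R
    by (simp add: Int_def)
  have "(\<Sum>j<n. card {i. i < M \<and> (j + i) mod n \<in> D})
      = (\<Sum>i<M. card {j. j < n \<and> (j + i) mod n \<in> D})"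
    unfolding card_bool by (rule sum.swap)
  then show ?thesis by (simp only: card_shift_mod_preimage[OF assms]) simp
qed

lemma listset_iff_list_all2: "xs \<in> listset As \<longleftrightarrow> list_all2 (\<in>) xs As"
  by (induction As arbitrary: xs) (auto simp: set_Cons_def list_all2_Cons2)

text \<open>A cyclic window of constant length meets many fibres in many points, and has only boundedly many
  subsets, so one subset of it lies in a positive proportion of all fibres.\<close>
lemma dense_tuples_contain_box:
  fixes c :: real
  assumes "c > 0"
  shows "\<exists>n0. \<forall>n\<ge>n0. \<forall>P. P \<subseteq> {xs. set xs \<subseteq> {..<n} \<and> length xs = r} \<and> c * real n ^ r \<le> real (card P)
    \<longrightarrow> (\<exists>Ws. length Ws = r \<and> (\<forall>W\<in>set Ws. W \<subseteq> {..<n} \<and> card W = m) \<and> listset Ws \<subseteq> P)"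
  using assms
proof (induction r arbitrary: c)
  case 0
  have "[] \<in> P" if "P \<subseteq> {xs. set xs \<subseteq> {..<n} \<and> length xs = 0}" "c * real n ^ 0 \<le> real (card P)" for P :: "nat list set" and n
    using that 0 by (cases "P = {}") auto
  then show ?case by (intro exI[of _ 0]) auto
next
  case (Suc r)
  \<comment> \<open>The window length is chosen so that the average trace of a fibre on a window is
    at least \<open>c * M \<ge> 2 * m\<close>; fibres with small traces then account for at most
    half of this.\<close>
  define M where "M = nat \<lceil>2 * real m / c\<rceil> + 1"
  have M: "c * real M / 2 \<ge> real m" "M > 0"
  proof -
    have "2 * real m / c \<le> real M" unfolding M_def by linarith
    then show "c * real M / 2 \<ge> real m" using Suc.prems by (simp add: field_simps)
  qed (simp add: M_def)
  \<comment> \<open>The factor 2 pays for the fibres with small trace, \<open>2 ^ M\<close> for the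
    pigeonhole over the possible traces.\<close>
  define c' where "c' = c / 2 / 2 ^ M"
  have "c' > 0" using Suc.prems by (simp add: c'_def)
  from Suc.IH[OF this] obtain n0 where n0: "\<forall>n\<ge>n0. \<forall>P. P \<subseteq> {xs. set xs \<subseteq> {..<n} \<and> length xs = r} \<and> c' * real n ^ r \<le> real (card P)
    \<longrightarrow> (\<exists>Ws. length Ws = r \<and> (\<forall>W\<in>set Ws. W \<subseteq> {..<n} \<and> card W = m) \<and> listset Ws \<subseteq> P)" ..
  show ?case
  \<comment> \<open>\<open>n \<ge> M\<close> keeps a window from wrapping onto itself, so distinct
    offsets give distinct vertices.\<close>
  proof (intro exI[of _ "max n0 M"] allI impI, elim conjE)
    fix n P
    assume n: "max n0 M \<le> n" and P: "P \<subseteq> {xs. set xs \<subseteq> {..<n} \<and> length xs = Suc r}"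
      and cP: "c * real n ^ Suc r \<le> real (card P)"
    define L where "L = {xs. set xs \<subseteq> {..<n} \<and> length xs = r}"
    have finL: "finite L" unfolding L_def by (simp add: finite_lists_length_eq)
    have cardL: "card L = n ^ r" unfolding L_def by (simp add: card_lists_length_eq)
    define D where "D p = {v. v # p \<in> P}" for p
    have D: "D p \<subseteq> {..<n}" for p using P by (auto simp: D_def)
    then have finD: "finite (D p)" for p using finite_subset by blast
    have "P = (\<Union>p\<in>L. (\<lambda>v. v # p) ` D p)"
    proof (intro equalityI subsetI)
      fix xs assume xs: "xs \<in> P"
      with P have "set xs \<subseteq> {..<n}" "length xs = Suc r" by auto
      with xs show "xs \<in> (\<Union>p\<in>L. (\<lambda>v. v # p) ` D p)" by (cases xs) (auto simp: L_def D_def)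
    qed (auto simp: D_def)
    then have "card P = card (\<Union>p\<in>L. (\<lambda>v. v # p) ` D p)" by (rule arg_cong)
    also have "\<dots> = (\<Sum>p\<in>L. card ((\<lambda>v. v # p) ` D p))"
      by (rule card_UN_disjoint) (use finL finD in auto)
    finally have cardP: "card P = (\<Sum>p\<in>L. card (D p))" by (simp add: card_image inj_on_def)
    define B where "B j p = {i. i < M \<and> (j + i) mod n \<in> D p}" for j p
    have "(\<Sum>j<n. \<Sum>p\<in>L. card (B j p)) = M * card P"
      unfolding B_def cardP by (subst sum.swap) (simp add: sum_card_windows[OF D] sum_distrib_left)
    then have "real (\<Sum>j<n. \<Sum>p\<in>L. card (B j p)) = real (M * card P)" by (rule arg_cong)
    then have tot: "(\<Sum>j<n. \<Sum>p\<in>L. real (card (B j p))) = real M * real (card P)" by simp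
    have npos: "n > 0" using n M by auto
    have "\<exists>j<n. c * real M * real n ^ r \<le> (\<Sum>p\<in>L. real (card (B j p)))"
    proof (rule ccontr)
      assume "\<not> ?thesis"
      then have "(\<Sum>j<n. \<Sum>p\<in>L. real (card (B j p))) < (\<Sum>j<n. c * real M * real n ^ r)"
        using npos by (intro sum_strict_mono) (auto simp: not_le)
      also have "\<dots> = real M * (c * real n ^ Suc r)" by (simp add: mult_ac)
      also have "\<dots> \<le> real M * real (card P)" using cP by (intro mult_left_mono) auto
      finally show False using tot by simp
    qed
    then obtain j where j: "j < n" "c * real M * real n ^ r \<le> (\<Sum>p\<in>L. real (card (B j p)))" by blast
    define H where "H = {p \<in> L. m \<le> card (B j p)}"
    have H: "H \<subseteq> L" "finite H" using finL by (auto simp: H_def)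
    \<comment> \<open>A fibre outside \<open>H\<close> contributes less than \<open>m\<close>, one
      in \<open>H\<close> at most \<open>M\<close>; hence \<open>H\<close> has density at least
      \<open>c / 2\<close> among all \<open>p\<close>.\<close>
    have "(\<Sum>p\<in>L. real (card (B j p))) \<le> (\<Sum>p\<in>L. real m + (if p \<in> H then real M else 0))"
    proof (intro sum_mono)
      fix p assume "p \<in> L"
      have "card (B j p) \<le> card {..<M}" by (intro card_mono) (auto simp: B_def)
      with \<open>p \<in> L\<close> show "real (card (B j p)) \<le> real m + (if p \<in> H then real M else 0)"
        by (auto simp: H_def)
    qed
    also have "\<dots> = real m * real n ^ r + real M * real (card H)"
      using H finL by (simp add: sum.distrib cardL sum.If_cases Int_absorb1 mult_ac)
    also have "\<dots> \<le> (c * real M / 2) * real n ^ r + real M * real (card H)"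
      using M by (intro add_mono mult_right_mono) auto
    finally have "real M * (c / 2 * real n ^ r) \<le> real M * real (card H)" using j by (simp add: algebra_simps)
    then have cH: "c / 2 * real n ^ r \<le> real (card H)" using M by (simp add: mult_le_cancel_left)
    have img: "B j ` H \<subseteq> Pow {..<M}" by (auto simp: B_def)
    have "\<exists>S\<in>Pow {..<M}. c' * real n ^ r \<le> real (card {p\<in>H. B j p = S})"
    proof (rule ccontr)
      assume "\<not> ?thesis"
      then have "(\<Sum>S\<in>Pow {..<M}. real (card {p\<in>H. B j p = S})) < (\<Sum>S\<in>Pow {..<M}. c' * real n ^ r)"
        by (intro sum_strict_mono) (auto simp: not_le)
      also have "\<dots> = c / 2 * real n ^ r" by (simp add: c'_def card_Pow)
      finally have lt: "(\<Sum>S\<in>Pow {..<M}. real (card {p\<in>H. B j p = S})) < real (card H)" using cH by simp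
      have "(\<Sum>S\<in>Pow {..<M}. \<Sum>p\<in>{p\<in>H. B j p = S}. 1) = (\<Sum>p\<in>H. 1::nat)"
        using img H by (intro sum.group) auto
      then have "(\<Sum>S\<in>Pow {..<M}. card {p\<in>H. B j p = S}) = card H" by simp
      then have "real (\<Sum>S\<in>Pow {..<M}. card {p\<in>H. B j p = S}) = real (card H)" by (rule arg_cong)
      with lt show False by simp
    qed
    then obtain S where S: "S \<subseteq> {..<M}" "c' * real n ^ r \<le> real (card {p\<in>H. B j p = S})" by blast
    have "card {p\<in>H. B j p = S} > 0"
    proof -
      have "0 < c' * real n ^ r" using \<open>c' > 0\<close> npos by simp
      then show ?thesis using S(2) by linarith
    qed
    then have "{p\<in>H. B j p = S} \<noteq> {}" by (metis card.empty less_irrefl)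
    then obtain p0 where "p0 \<in> H" "B j p0 = S" by blast
    then have "m \<le> card S" by (auto simp: H_def)
    then obtain S' where S': "S' \<subseteq> S" "card S' = m" by (rule obtain_subset_with_card_n)
    define W where "W = (\<lambda>i. (j + i) mod n) ` S'"
    have "inj_on (\<lambda>i. (i + j) mod n) S'"
      using S' S n by (intro inj_on_subset[OF inj_on_shift_mod]) auto
    then have "inj_on (\<lambda>i. (j + i) mod n) S'" by (simp add: add.commute)
    then have W: "card W = m" "W \<subseteq> {..<n}" using S' npos by (auto simp: W_def card_image)
    define P' where "P' = {p\<in>H. B j p = S}"
    have "P' \<subseteq> {xs. set xs \<subseteq> {..<n} \<and> length xs = r}" using H by (auto simp: P'_def L_def)
    then obtain Ws where Ws: "length Ws = r" "\<forall>W\<in>set Ws. W \<subseteq> {..<n} \<and> card W = m" "listset Ws \<subseteq> P'"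
      using n0[rule_format, of n P'] n S(2) unfolding P'_def by auto
    have "v # p \<in> P" if "v \<in> W" "p \<in> P'" for v p
      using that S'(1) by (auto simp: W_def P'_def B_def D_def)
    then have "listset (W # Ws) \<subseteq> P" using Ws(3) by (auto simp: set_Cons_def)
    then show "\<exists>Ws. length Ws = Suc r \<and> (\<forall>W\<in>set Ws. W \<subseteq> {..<n} \<and> card W = m) \<and> listset Ws \<subseteq> P"
      using Ws W by (intro exI[of _ "W # Ws"]) auto
  qed
qed

section \<open>Neighbourhoods, cliques and greedy clique growth\<close>

lemma simple_graphD:
  assumes "simple_graph n E" "{u, v} \<in> E"
  shows "u \<noteq> v" "u < n" "v < n"
  using assms unfolding simple_graph_def by (metis doubleton_eq_iff)+

definition nbrs :: "nat set set \<Rightarrow> nat \<Rightarrow> nat set" where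
  "nbrs E v = {u. {u, v} \<in> E}"

lemma nbrs_sym: "u \<in> nbrs E v \<longleftrightarrow> v \<in> nbrs E u"
  by (simp add: nbrs_def insert_commute)

lemma degree_eq_card_nbrs: "degree E v = card (nbrs E v)"
  by (simp add: degree_def nbrs_def)

lemma nbrs_subset: "simple_graph n E \<Longrightarrow> nbrs E v \<subseteq> {..<n}"
  unfolding nbrs_def by (auto dest: simple_graphD)

lemma nbrs_irrefl: "simple_graph n E \<Longrightarrow> v \<notin> nbrs E v"
  unfolding nbrs_def using simple_graphD(1)[of n E v v] by auto

text \<open>Ordered lists are used so that the box lemma for sets of tuples applies directly;
  \<open>sorted_wrt\<close> relates every earlier entry to every later one, not only consecutive
  entries.\<close>

definition cliques :: "nat set set \<Rightarrow> nat set \<Rightarrow> nat \<Rightarrow> nat list set" where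
  "cliques E A r = {xs. set xs \<subseteq> A \<and> length xs = r \<and> sorted_wrt (\<lambda>u v. {u, v} \<in> E) xs}"

lemma finite_cliques: "finite A \<Longrightarrow> finite (cliques E A r)"
  unfolding cliques_def by (rule finite_subset[OF _ finite_lists_length_eq[of A r]]) auto

text \<open>The pairs list the chosen vertices together with their parts; \<open>f A\<close> is the score used when \<open>A\<close> is the
  current common neighbourhood, and fewer than \<open>h\<close> vertices may beat the chosen one.\<close>
inductive greedy :: "nat set set \<Rightarrow> (nat set \<Rightarrow> nat \<Rightarrow> real) \<Rightarrow> nat \<Rightarrow> nat set \<Rightarrow> (nat \<times> nat set) list \<Rightarrow> bool"
  for E f h where
  stop: "card A < h \<Longrightarrow> greedy E f h A []"
| step: "w \<in> A \<Longrightarrow> card {v \<in> A. f A w < f A v} < h \<Longrightarrow> greedy E f h (A \<inter> nbrs E w) ps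
    \<Longrightarrow> greedy E f h A ((w, A - nbrs E w) # ps)"

lemma obtain_top_subset:
  fixes g :: "'a \<Rightarrow> real"
  assumes "finite A" "h \<le> card A"
  obtains T where "T \<subseteq> A" "card T = h" "\<And>t v. t \<in> T \<Longrightarrow> v \<in> A - T \<Longrightarrow> g v \<le> g t"
proof -
  have "\<exists>T\<subseteq>A. card T = h \<and> (\<forall>t\<in>T. \<forall>v\<in>A - T. g v \<le> g t)"
    using assms(2)
  proof (induction h)
    case (Suc h)
    then obtain T where T: "T \<subseteq> A" "card T = h" "\<forall>t\<in>T. \<forall>v\<in>A - T. g v \<le> g t" by auto
    have "A - T \<noteq> {}" using Suc.prems T assms(1) by (auto dest: card_mono)
    moreover have "finite (A - T)" using assms(1) by simp
    ultimately have "Max (g ` (A - T)) \<in> g ` (A - T)" "\<forall>v\<in>A - T. g v \<le> Max (g ` (A - T))"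
      by (auto intro!: Max_in)
    then obtain x where x: "x \<in> A - T" "\<forall>v\<in>A - T. g v \<le> g x" by auto
    have "finite T" using T(1) assms(1) by (rule finite_subset)
    with x T show ?case by (intro exI[of _ "insert x T"]) auto
  qed auto
  with that show ?thesis by blast
qed

text \<open>Each of the \<open>h\<close> vertices of highest score is an admissible greedy choice,
  because only the others among them can beat it. If none of them starts a short run, then by
  induction each is the first vertex of at least \<open>h ^ r\<close> cliques of size
  \<open>r + 1\<close>.\<close>

lemma greedy_or_many_cliques:
  assumes "finite A" "h > 0"
  shows "h ^ r \<le> card (cliques E A r) \<or> (\<exists>ps. greedy E f h A ps \<and> length ps < r)"
  using assms(1)
proof (induction r arbitrary: A)
  case 0
  have "cliques E A 0 = {[]}" by (auto simp: cliques_def)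
  then show ?case by simp
next
  case (Suc r)
  show ?case
  proof (cases "card A < h")
    case True
    then show ?thesis using greedy.stop by fastforce
  next
    case False
    then obtain T where T: "T \<subseteq> A" "card T = h" "\<And>t v. t \<in> T \<Longrightarrow> v \<in> A - T \<Longrightarrow> f A v \<le> f A t"
      using obtain_top_subset[OF Suc.prems, of h "f A"] by (metis not_less)
    have finT: "finite T" using T(1) Suc.prems by (rule finite_subset)
    show ?thesis
    proof (cases "\<exists>w\<in>T. \<exists>ps. greedy E f h (A \<inter> nbrs E w) ps \<and> length ps < r")
      case True
      then obtain w ps where w: "w \<in> T" and ps: "greedy E f h (A \<inter> nbrs E w) ps" "length ps < r" by blast
      have "{v \<in> A. f A w < f A v} \<subseteq> T - {w}" using T(3)[OF w] by force
      then have "card {v \<in> A. f A w < f A v} \<le> card (T - {w})" using finT by (intro card_mono) auto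
      also have "\<dots> < h" using w T(2) \<open>h > 0\<close> finT by simp
      finally have "greedy E f h A ((w, A - nbrs E w) # ps)"
        using w T(1) ps(1) by (intro greedy.step) auto
      then show ?thesis using ps(2) by force
    next
      case False
      then have c: "h ^ r \<le> card (cliques E (A \<inter> nbrs E w) r)" if "w \<in> T" for w
        using Suc.IH[of "A \<inter> nbrs E w"] Suc.prems that by blast
      have "h ^ Suc r = (\<Sum>w\<in>T. h ^ r)" by (simp add: T(2))
      also have "\<dots> \<le> (\<Sum>w\<in>T. card ((\<lambda>xs. w # xs) ` cliques E (A \<inter> nbrs E w) r))"
        using c by (intro sum_mono) (simp add: card_image inj_on_def)
      also have "\<dots> = card (\<Union>w\<in>T. (\<lambda>xs. w # xs) ` cliques E (A \<inter> nbrs E w) r)"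
        by (rule card_UN_disjoint[symmetric]) (use finT Suc.prems finite_cliques in auto)
      also have "\<dots> \<le> card (cliques E A (Suc r))"
      proof (rule card_mono[OF finite_cliques[OF Suc.prems]])
        show "(\<Union>w\<in>T. (\<lambda>xs. w # xs) ` cliques E (A \<inter> nbrs E w) r) \<subseteq> cliques E A (Suc r)"
          using T(1) by (auto simp: cliques_def nbrs_def insert_commute)
      qed
      finally show ?thesis ..
    qed
  qed
qed

text \<open>A positive density of \<open>r\<close>-cliques contains all transversals of some
  \<open>r\<close> sets of size \<open>m\<close>. These sets are completely joined to each other,
  and \<open>F\<close> embeds by sending colour class \<open>i\<close> into the \<open>i\<close>-th
  set.\<close>

lemma F_free_few_cliques:
  fixes c :: real
  assumes "c > 0" "m > 0" "simple_graph m EF" "proper_colouring m EF r \<kappa>"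
  shows "\<exists>n0. \<forall>n\<ge>n0. \<forall>E. simple_graph n E \<and> F_free n E m EF
    \<longrightarrow> real (card (cliques E {..<n} r)) < c * real n ^ r"
proof -
  obtain n0 where n0: "\<forall>n\<ge>n0. \<forall>P. P \<subseteq> {xs. set xs \<subseteq> {..<n} \<and> length xs = r} \<and> c * real n ^ r \<le> real (card P)
    \<longrightarrow> (\<exists>Ws. length Ws = r \<and> (\<forall>W\<in>set Ws. W \<subseteq> {..<n} \<and> card W = m) \<and> listset Ws \<subseteq> P)"
    using dense_tuples_contain_box[OF assms(1)] ..
  have "contains_subgraph n E m EF"
    if "n \<ge> n0" and E: "simple_graph n E" and "c * real n ^ r \<le> real (card (cliques E {..<n} r))" for n E
  proof -
    have "cliques E {..<n} r \<subseteq> {xs. set xs \<subseteq> {..<n} \<and> length xs = r}" by (auto simp: cliques_def)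
    with that(3) n0[rule_format, OF that(1), of "cliques E {..<n} r"] obtain Ws where Ws: "length Ws = r" "\<forall>W\<in>set Ws. W \<subseteq> {..<n} \<and> card W = m" "listset Ws \<subseteq> cliques E {..<n} r"
      by blast
    have W: "Ws ! i \<subseteq> {..<n}" "card (Ws ! i) = m" if "i < r" for i
      using Ws(2)[rule_format, OF nth_mem[of i Ws]] Ws(1) that by auto
    have adj: "{a, b} \<in> E" if "i < j" "j < r" "a \<in> Ws ! i" "b \<in> Ws ! j" for i j a b
    proof -
      \<comment> \<open>\<open>a\<close> and \<open>b\<close> are completed to a transversal by
        arbitrary representatives of the other sets; every transversal is a clique.\<close>
      define xs where "xs = map (\<lambda>l. if l = i then a else if l = j then b else (SOME v. v \<in> Ws ! l)) [0..<r]"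
      have "(SOME v. v \<in> Ws ! l) \<in> Ws ! l" if "l < r" for l
        using W(2)[OF that] \<open>m > 0\<close> by (metis card.empty less_irrefl some_in_eq)
      then have "list_all2 (\<in>) xs Ws" using that Ws(1) by (auto simp: xs_def list_all2_conv_all_nth)
      then have "xs \<in> cliques E {..<n} r" using Ws(3) by (auto simp: listset_iff_list_all2)
      then have "sorted_wrt (\<lambda>u v. {u, v} \<in> E) xs" by (simp add: cliques_def)
      moreover have "i < length xs" "j < length xs" "xs ! i = a" "xs ! j = b" using that by (auto simp: xs_def)
      ultimately show ?thesis using that(1) by (metis sorted_wrt_iff_nth_less)
    qed
    then have adj': "{a, b} \<in> E" if "i \<noteq> j" "i < r" "j < r" "a \<in> Ws ! i" "b \<in> Ws ! j" for i j a b
      using that by (metis insert_commute linorder_neqE_nat)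
    have "\<exists>g. bij_betw g {..<m} (Ws ! i)" if "i < r" for i
      using W[OF that] by (intro finite_same_card_bij) (auto intro: finite_subset)
    then obtain g where g: "\<And>i. i < r \<Longrightarrow> bij_betw (g i) {..<m} (Ws ! i)" by metis
    have \<kappa>: "\<kappa> v < r" if "v < m" for v using assms(4) that by (simp add: proper_colouring_def)
    have mem: "g (\<kappa> v) v \<in> Ws ! \<kappa> v" if "v < m" for v
      using g[OF \<kappa>[OF that]] that by (auto simp: bij_betw_def)
    show ?thesis unfolding contains_subgraph_def
    proof (intro exI[of _ "\<lambda>v. g (\<kappa> v) v"] conjI ballI)
      show "inj_on (\<lambda>v. g (\<kappa> v) v) {..<m}"
      proof (rule inj_onI)
        fix u v assume uv: "u \<in> {..<m}" "v \<in> {..<m}" "g (\<kappa> u) u = g (\<kappa> v) v"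
        then have lt: "u < m" "v < m" by auto
        \<comment> \<open>Sets of different colours are disjoint, since a common vertex would be
          adjacent to itself.\<close>
        have "\<kappa> u = \<kappa> v"
          using adj'[OF _ \<kappa>[OF lt(1)] \<kappa>[OF lt(2)] mem[OF lt(1)] mem[OF lt(2)]] simple_graphD(1)[OF E] uv(3) by metis
        then show "u = v" using g[OF \<kappa>[OF lt(1)]] uv by (auto simp: bij_betw_def inj_on_def)
      qed
      show "(\<lambda>v. g (\<kappa> v) v) ` {..<m} \<subseteq> {..<n}" using mem W(1) \<kappa> by blast
      fix e assume e: "e \<in> EF"
      with assms(3) obtain u v where uv: "e = {u, v}" "u < m" "v < m" unfolding simple_graph_def by blast
      with e assms(4) have "\<kappa> u \<noteq> \<kappa> v" by (auto simp: proper_colouring_def)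
      then show "(\<lambda>v. g (\<kappa> v) v) ` e \<in> E"
        using adj'[OF _ \<kappa>[OF uv(2)] \<kappa>[OF uv(3)] mem[OF uv(2)] mem[OF uv(3)]] uv(1) by simp
    qed
  qed
  then show ?thesis unfolding F_free_def by (metis not_less)
qed

text \<open>The identity is a proper colouring with \<open>m\<close> colours, so the
  \<open>LEAST\<close> is attained.\<close>

lemma chromatic_number_colouring:
  assumes "simple_graph m EF"
  obtains \<kappa> where "proper_colouring m EF (chromatic_number m EF) \<kappa>"
proof -
  have "proper_colouring m EF m (\<lambda>v. v)"
    using assms by (auto simp: proper_colouring_def dest: simple_graphD)
  then have "\<exists>\<kappa>. proper_colouring m EF (chromatic_number m EF) \<kappa>"
    unfolding chromatic_number_def by (intro LeastI[where P = "\<lambda>c. \<exists>\<kappa>. proper_colouring m EF c \<kappa>" and k = m]) blast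
  with that show ?thesis by blast
qed

section \<open>Eigenvectors of the signless Laplacian\<close>

text \<open>A complex eigenvalue exists. For its eigenvector \<open>z\<close> the form
  \<open>S\<close> is real by symmetry and equals the eigenvalue times the squared norm of
  \<open>z\<close>, so the eigenvalue is real. Hence the \<open>Max\<close> in
  \<open>q_index\<close> ranges over a nonempty set.\<close>

lemma symmetric_real_mat_has_eigenvalue:
  fixes A :: "real mat"
  assumes A: "A \<in> carrier_mat n n" and "n > 0"
    and sym: "\<And>i j. i < n \<Longrightarrow> j < n \<Longrightarrow> A $$ (i, j) = A $$ (j, i)"
  shows "\<exists>x. eigenvalue A x"
proof -
  define C where "C = map_mat complex_of_real A"
  have C: "C \<in> carrier_mat n n" using A by (simp add: C_def)
  from spectrum_non_empty[OF C \<open>n > 0\<close>] obtain \<mu> where \<mu>: "eigenvalue C \<mu>" by (auto simp: spectrum_def)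
  then obtain z where z: "z \<in> carrier_vec n" "z \<noteq> 0\<^sub>v n" "C *\<^sub>v z = \<mu> \<cdot>\<^sub>v z"
    using C by (auto simp: eigenvalue_def eigenvector_def)
  have ev: "(\<Sum>j<n. of_real (A $$ (i, j)) * z $ j) = \<mu> * z $ i" if "i < n" for i
  proof -
    have "(C *\<^sub>v z) $ i = (\<Sum>j<n. of_real (A $$ (i, j)) * z $ j)"
      using that A z(1) by (simp add: C_def scalar_prod_def atLeast0LessThan)
    then show ?thesis using z that by simp
  qed
  define S where "S = (\<Sum>i<n. \<Sum>j<n. of_real (A $$ (i, j)) * cnj (z $ i) * z $ j)"
  have "cnj S = (\<Sum>i<n. \<Sum>j<n. of_real (A $$ (j, i)) * cnj (z $ j) * z $ i)"
    unfolding S_def cnj_sum by (intro sum.cong refl) (simp add: sym mult_ac)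
  also have "\<dots> = S" unfolding S_def by (rule sum.swap)
  finally have "Im S = 0" by (simp add: complex_eq_iff)
  define N where "N = (\<Sum>i<n. (cmod (z $ i))\<^sup>2)"
  have "S = (\<Sum>i<n. cnj (z $ i) * (\<Sum>j<n. of_real (A $$ (i, j)) * z $ j))"
    unfolding S_def by (simp add: sum_distrib_left mult_ac)
  also have "\<dots> = (\<Sum>i<n. \<mu> * of_real ((cmod (z $ i))\<^sup>2))"
  proof (intro sum.cong refl)
    fix i assume "i \<in> {..<n}"
    then have "i < n" by simp
    have "cnj (z $ i) * (\<Sum>j<n. of_real (A $$ (i, j)) * z $ j) = \<mu> * (z $ i * cnj (z $ i))"
      unfolding ev[OF \<open>i < n\<close>] by (simp add: mult_ac)
    then show "cnj (z $ i) * (\<Sum>j<n. of_real (A $$ (i, j)) * z $ j) = \<mu> * of_real ((cmod (z $ i))\<^sup>2)"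
      by (simp only: complex_norm_square)
  qed
  also have "\<dots> = \<mu> * of_real N" by (simp add: N_def sum_distrib_left)
  finally have "Im \<mu> * N = 0" using \<open>Im S = 0\<close> by simp
  moreover have "N \<noteq> 0"
  proof
    assume "N = 0"
    then have "\<forall>i<n. z $ i = 0" by (simp add: N_def sum_nonneg_eq_0_iff)
    then have "z = 0\<^sub>v n" using z(1) by (intro eq_vecI) auto
    with z(2) show False ..
  qed
  ultimately have "\<mu> = complex_of_real (Re \<mu>)" by (simp add: complex_eq_iff)
  moreover have "poly (char_poly C) \<mu> = 0" using \<mu> eigenvalue_root_char_poly[OF C] by simp
  ultimately have "poly (map_poly complex_of_real (char_poly A)) (complex_of_real (Re \<mu>)) = 0"
    unfolding C_def using of_real_hom.char_poly_hom[OF A, where ?'a = complex] by metis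
  then have "poly (char_poly A) (Re \<mu>) = 0" by simp
  then show ?thesis using eigenvalue_root_char_poly[OF A] by blast
qed

lemma signless_laplacian_mult_vec:
  assumes "simple_graph n E" "y \<in> carrier_vec n" "i < n"
  shows "(signless_laplacian n E *\<^sub>v y) $ i = real (degree E i) * y $ i + (\<Sum>j\<in>nbrs E i. y $ j)"
proof -
  have "(signless_laplacian n E *\<^sub>v y) $ i
      = (\<Sum>j<n. (if i = j then real (degree E i) else if {i, j} \<in> E then 1 else 0) * y $ j)"
    using assms(2,3) by (simp add: signless_laplacian_def scalar_prod_def atLeast0LessThan)
  also have "\<dots> = (\<Sum>j<n. (if j = i then real (degree E i) * y $ j else 0) + (if j \<in> nbrs E i then y $ j else 0))"
    using nbrs_irrefl[OF assms(1), of i] by (intro sum.cong refl) (auto simp: nbrs_def insert_commute)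
  also have "\<dots> = real (degree E i) * y $ i + (\<Sum>j\<in>nbrs E i. y $ j)"
    using nbrs_subset[OF assms(1), of i] assms(3) by (simp add: sum.distrib sum.inter_restrict[symmetric] Int_absorb1)
  finally show ?thesis .
qed

text \<open>Absolute values and the triangle inequality turn the eigenvalue equation into an
  inequality for a nonnegative vector. This suffices below and takes the place of the
  Perron-Frobenius theorem.\<close>

lemma q_index_subeigenvector:
  assumes "simple_graph n E" "n > 0" "q \<le> q_index n E"
  obtains x where "\<And>v. 0 \<le> x v" "\<exists>v<n. x v \<noteq> 0"
    "\<And>v. v < n \<Longrightarrow> q * x v \<le> real (degree E v) * x v + (\<Sum>u\<in>nbrs E v. x u)"
proof -
  let ?A = "signless_laplacian n E"
  have A: "?A \<in> carrier_mat n n" by (simp add: signless_laplacian_def)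
  have "finite {x. eigenvalue ?A x}" using card_finite_spectrum(1)[OF A] by (simp add: spectrum_def)
  moreover have "{x. eigenvalue ?A x} \<noteq> {}"
    using symmetric_real_mat_has_eigenvalue[OF A assms(2)]
    by (auto simp: signless_laplacian_def insert_commute)
  ultimately have "eigenvalue ?A (q_index n E)" unfolding q_index_def using Max_in by blast
  then obtain y where y: "y \<in> carrier_vec n" "y \<noteq> 0\<^sub>v n" "?A *\<^sub>v y = q_index n E \<cdot>\<^sub>v y"
    using A by (auto simp: eigenvalue_def eigenvector_def)
  have "q * \<bar>y $ v\<bar> \<le> real (degree E v) * \<bar>y $ v\<bar> + (\<Sum>u\<in>nbrs E v. \<bar>y $ u\<bar>)" if "v < n" for v
  proof -
    have "q * \<bar>y $ v\<bar> \<le> \<bar>q_index n E * y $ v\<bar>"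
      using assms(3) by (simp add: abs_mult) (intro mult_right_mono, auto)
    also have "q_index n E * y $ v = real (degree E v) * y $ v + (\<Sum>u\<in>nbrs E v. y $ u)"
      using signless_laplacian_mult_vec[OF assms(1) y(1) that] y(1,3) that by simp
    also have "\<bar>\<dots>\<bar> \<le> real (degree E v) * \<bar>y $ v\<bar> + (\<Sum>u\<in>nbrs E v. \<bar>y $ u\<bar>)"
      by (rule order_trans[OF abs_triangle_ineq add_mono]) (simp_all add: abs_mult sum_abs)
    finally show ?thesis .
  qed
  moreover have "\<exists>v<n. \<bar>y $ v\<bar> \<noteq> 0"
  proof (rule ccontr)
    assume "\<not> ?thesis"
    then have "y = 0\<^sub>v n" using y(1) by (intro eq_vecI) auto
    with y(2) show False ..
  qed
  ultimately show ?thesis by (intro that[of "\<lambda>v. \<bar>y $ v\<bar>"]) auto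
qed

section \<open>Edge density from the signless Laplacian index\<close>

text \<open>Here \<open>\<alpha> i\<close> is the relative size of part \<open>i\<close>, \<open>\<beta> i\<close> its share of the eigenvector and \<open>a i\<close>
  the entry at its chosen vertex. The bound \<open>\<beta>le\<close> is the second order expansion of \<open>\<alpha> / (\<gamma> + 2\<alpha>)\<close> at \<open>\<alpha> = 1/k\<close>.\<close>
lemma balanced_weights:
  fixes \<alpha> \<beta> a :: "nat \<Rightarrow> real" and k :: nat
  defines "\<gamma> \<equiv> 1 - 2 / real k"
  assumes k: "k \<ge> 3" and s: "0 \<le> s" "s \<le> 1" and e: "18 * real k * e = s\<^sup>2"
    and \<alpha>: "\<And>i. i < k \<Longrightarrow> 0 \<le> \<alpha> i" and a: "\<And>i. i < k \<Longrightarrow> 0 \<le> a i \<and> a i \<le> 6"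
    and \<beta>\<alpha>: "\<And>i. i < k \<Longrightarrow> \<beta> i * (\<gamma> + 2 * \<alpha> i) \<le> \<alpha> i + e"
    and a\<beta>: "\<And>i. i < k \<Longrightarrow> a i * (\<gamma> + \<alpha> i) \<le> 1 - \<beta> i + 6 * e"
    and sum\<alpha>: "(\<Sum>i<k. \<alpha> i) \<le> 1" and sum\<beta>: "1 - e \<le> (\<Sum>i<k. \<beta> i)"
    and i: "i < k"
  shows "a i \<le> 1 + 12 * s"
proof -
  define t where "t i = \<alpha> i - 1 / real k" for i
  have kr: "real k \<ge> 3" using k by simp
  have "0 \<le> real k * e" using e zero_le_power2[of s] by linarith
  then have e0: "0 \<le> e" using kr by (simp add: zero_le_mult_iff)
  have \<gamma>: "1 / 3 \<le> \<gamma>" "\<gamma> \<le> 1" using kr by (auto simp: \<gamma>_def field_simps)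
  have \<gamma>t: "\<gamma> + 2 * \<alpha> i = 1 + 2 * t i" for i by (simp add: \<gamma>_def t_def field_simps)
  have \<alpha>1: "\<alpha> i \<le> 1" if "i < k" for i
    using member_le_sum[of i "{..<k}" \<alpha>] \<alpha> that sum\<alpha> by auto
  have \<beta>le: "\<beta> i \<le> 1 / real k + \<gamma> * t i - 2 / 9 * (t i)\<^sup>2 + 3 * e" if "i < k" for i
  proof (rule ccontr)
    \<comment> \<open>\<open>D\<close> equals \<open>\<gamma> + 2 * \<alpha> i\<close>, the
      denominator of the expanded function. Multiplying by it makes the comparison polynomial; the
      bounds 1/3 and 3 on \<open>D\<close> settle the two signs of the remainder
      \<open>r\<close>.\<close>
    define D where "D = 1 + 2 * t i"
    have D: "1 / 3 \<le> D" "D \<le> 3" using \<gamma> \<alpha>[OF that] \<alpha>1[OF that] \<gamma>t[of i] by (auto simp: D_def)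
    define y where "y = \<beta> i - 1 / real k - \<gamma> * t i"
    define r where "r = 3 * e - 2 / 9 * (t i)\<^sup>2"
    assume "\<not> ?thesis"
    then have "r < y" by (simp add: y_def r_def)
    then have "D * r < D * y" using D by simp
    moreover have "D * y \<le> e - 2 / 3 * (t i)\<^sup>2"
    proof -
      have "D * (1 / real k + \<gamma> * t i) = \<alpha> i + 2 * \<gamma> * (t i)\<^sup>2"
        using kr by (simp add: D_def t_def \<gamma>_def power2_eq_square field_simps)
      then have "D * y \<le> e - 2 * \<gamma> * (t i)\<^sup>2"
        using \<beta>\<alpha>[OF that] unfolding \<gamma>t D_def[symmetric] by (simp add: y_def algebra_simps)
      moreover have "2 / 3 * (t i)\<^sup>2 \<le> 2 * \<gamma> * (t i)\<^sup>2" using \<gamma> by (intro mult_right_mono) auto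
      ultimately show ?thesis by linarith
    qed
    moreover have "e - 2 / 3 * (t i)\<^sup>2 \<le> D * r"
    proof (cases "r \<ge> 0")
      case True
      then have "1 / 3 * r \<le> D * r" using D by (intro mult_right_mono) auto
      moreover have "e - 2 / 3 * (t i)\<^sup>2 \<le> 1 / 3 * r" by (simp add: r_def)
      ultimately show ?thesis by linarith
    next
      case False
      then have "3 * r \<le> D * r" using D by (intro mult_right_mono_neg) auto
      moreover have "e - 2 / 3 * (t i)\<^sup>2 \<le> 3 * r" using e0 by (simp add: r_def)
      ultimately show ?thesis by linarith
    qed
    ultimately show False by linarith
  qed
  have sumt: "(\<Sum>i<k. t i) \<le> 0"
    using sum\<alpha> kr by (simp add: t_def sum_subtractf)
  \<comment> \<open>In the sum the linear terms are nonpositive, so the error bounds the quadratic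
    terms and every \<open>t i\<close> is small.\<close>
  have "1 - e \<le> (\<Sum>i<k. 1 / real k + \<gamma> * t i - 2 / 9 * (t i)\<^sup>2 + 3 * e)"
    using sum\<beta> sum_mono[of "{..<k}" \<beta>, OF \<beta>le] by auto
  also have "\<dots> = 1 + \<gamma> * (\<Sum>i<k. t i) - 2 / 9 * (\<Sum>i<k. (t i)\<^sup>2) + 3 * real k * e"
    using kr by (simp add: sum.distrib sum_subtractf sum_distrib_left)
  also have "\<dots> \<le> 1 - 2 / 9 * (\<Sum>i<k. (t i)\<^sup>2) + 3 * real k * e"
    using mult_nonneg_nonpos[of \<gamma> "\<Sum>i<k. t i"] \<gamma> sumt by simp
  finally have "2 / 9 * (\<Sum>i<k. (t i)\<^sup>2) \<le> 3 * real k * e + e" by simp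
  moreover have "e \<le> real k * e" using kr e0 mult_right_mono[of 1 "real k" e] by simp
  ultimately have "(\<Sum>i<k. (t i)\<^sup>2) \<le> s\<^sup>2" using e by simp
  then have "(t i)\<^sup>2 \<le> s\<^sup>2" using member_le_sum[of i "{..<k}" "\<lambda>i. (t i)\<^sup>2"] i by auto
  then have ti: "\<bar>t i\<bar> \<le> s" using s(1) by (metis abs_le_square_iff abs_of_nonneg)
  \<comment> \<open>The shares sum to almost 1, so the upper bounds on the others bound this one
    from below.\<close>
  have "1 / real k - 3 * real k * e - s \<le> \<beta> i"
  proof -
    have "(\<Sum>j\<in>{..<k} - {i}. \<beta> j) \<le> (\<Sum>j\<in>{..<k} - {i}. 1 / real k + \<gamma> * t j + 3 * e)"
    proof (rule sum_mono)
      fix j assume "j \<in> {..<k} - {i}"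
      then have "j < k" by simp
      from \<beta>le[OF this] show "\<beta> j \<le> 1 / real k + \<gamma> * t j + 3 * e"
        using zero_le_power2[of "t j"] by linarith
    qed
    also have "\<dots> = (\<Sum>j<k. 1 / real k + \<gamma> * t j + 3 * e) - (1 / real k + \<gamma> * t i + 3 * e)"
      using i by (simp add: sum_diff1 del: sum_constant)
    also have "(\<Sum>j<k. 1 / real k + \<gamma> * t j + 3 * e) = 1 + \<gamma> * (\<Sum>j<k. t j) + 3 * real k * e"
      using kr by (simp add: sum.distrib sum_distrib_left)
    finally have "(\<Sum>j\<in>{..<k} - {i}. \<beta> j) \<le> 1 + 3 * real k * e - 1 / real k - \<gamma> * t i - 3 * e"
      using mult_nonneg_nonpos[of \<gamma> "\<Sum>i<k. t i"] \<gamma> sumt by simp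
    moreover have "(\<Sum>j\<in>{..<k} - {i}. \<beta> j) = (\<Sum>j<k. \<beta> j) - \<beta> i"
      using i by (simp add: sum_diff1)
    moreover have "- \<gamma> * t i \<le> s"
    proof -
      have "- \<gamma> * t i \<le> \<gamma> * \<bar>t i\<bar>" using \<gamma> by (simp add: abs_if)
      also have "\<dots> \<le> 1 * s" using \<gamma> ti by (intro mult_mono) auto
      finally show ?thesis by simp
    qed
    ultimately show ?thesis using sum\<beta> e0 by linarith
  qed
  moreover have "\<gamma> + \<alpha> i = 1 - 1 / real k + t i" by (simp add: \<gamma>_def t_def)
  ultimately have "a i * (1 - 1 / real k + t i) \<le> 1 - 1 / real k + 3 * real k * e + s + 6 * e"
    using a\<beta>[OF i] by simp
  moreover have "- (a i * t i) \<le> 6 * s"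
  proof -
    have "- (a i * t i) \<le> a i * \<bar>t i\<bar>" using a[OF i] by (simp add: abs_if)
    also have "\<dots> \<le> 6 * s" using a[OF i] ti by (intro mult_mono) auto
    finally show ?thesis .
  qed
  moreover have "3 * real k * e + 6 * e \<le> s / 2"
  proof -
    have "6 * e \<le> 6 * (real k * e)" using kr e0 mult_right_mono[of 1 "real k" e] by simp
    moreover have "s\<^sup>2 \<le> s" using s by (simp add: power2_eq_square mult_left_le)
    ultimately show ?thesis using e by simp
  qed
  moreover have "(a i - 1) * (1 - 1 / real k) = a i * (1 - 1 / real k + t i) - a i * t i - (1 - 1 / real k)"
    by (simp add: algebra_simps diff_divide_distrib)
  ultimately have *: "(a i - 1) * (1 - 1 / real k) \<le> 15 / 2 * s" by linarith
  show ?thesis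
  proof (cases "a i \<le> 1")
    case False
    then have "(a i - 1) * (2 / 3) \<le> (a i - 1) * (1 - 1 / real k)"
      using kr by (intro mult_left_mono) (auto simp: field_simps)
    with * s show ?thesis by simp
  qed (use s in simp)
qed

text \<open>A greedy run may have fewer than \<open>k\<close> parts; it is padded with empty ones
  because the concavity argument compares exactly \<open>k\<close> sizes with
  \<open>1 / k\<close>.\<close>

definition part :: "(nat \<times> nat set) list \<Rightarrow> nat \<Rightarrow> nat set" where
  "part ps i = (if i < length ps then snd (ps ! i) else {})"

lemma sum_part:
  assumes "length ps \<le> k" "g {} = (0::'a::comm_monoid_add)"
  shows "(\<Sum>i<k. g (part ps i)) = (\<Sum>p\<leftarrow>ps. g (snd p))"
proof -
  have "(\<Sum>i<k. g (part ps i)) = (\<Sum>i<length ps. g (part ps i))"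
    using assms by (intro sum.mono_neutral_right) (auto simp: part_def)
  also have "\<dots> = (\<Sum>p\<leftarrow>ps. g (snd p))"
    by (simp add: sum_list_sum_nth part_def atLeast0LessThan)
  finally show ?thesis .
qed

text \<open>\<open>R\<close> is the common neighbourhood left when the run stops. Quantifying over
  \<open>g\<close> inside lets one \<open>R\<close> serve for cardinalities, eigenvector mass and
  counts of large entries.\<close>

lemma greedy_exhausts:
  assumes "greedy E f h A ps" "finite A"
  shows "\<exists>R\<subseteq>A. card R < h \<and> (\<forall>g::nat \<Rightarrow> real. sum g A = (\<Sum>p\<leftarrow>ps. sum g (snd p)) + sum g R)"
  using assms
proof induction
  case (step w A ps)
  then obtain R where R: "R \<subseteq> A \<inter> nbrs E w" "card R < h"
    "\<And>g::nat \<Rightarrow> real. sum g (A \<inter> nbrs E w) = (\<Sum>p\<leftarrow>ps. sum g (snd p)) + sum g R" by auto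
  have "sum g A = sum g (A \<inter> nbrs E w) + sum g (A - nbrs E w)" for g :: "nat \<Rightarrow> real"
    using step.prems by (rule sum.Int_Diff)
  then show ?case using R by (intro exI[of _ R]) (auto simp: add_ac)
qed auto

lemma greedy_part:
  assumes "greedy E (\<lambda>_. x) h A ps" "finite A" "(w, P) \<in> set ps"
  shows "w \<in> A" "P \<subseteq> A" "P \<inter> nbrs E w = {}" "card {v \<in> P. x w < x v} < h"
proof -
  have "w \<in> A \<and> P \<subseteq> A \<and> P \<inter> nbrs E w = {} \<and> card {v \<in> P. x w < x v} < h"
    using assms
  proof induction
    case (step w' A ps)
    have "card {v \<in> A - nbrs E w'. x w' < x v} \<le> card {v \<in> A. x w' < x v}"
      using step.prems(1) by (intro card_mono) auto
    then show ?case using step by auto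
  qed auto
  then show "w \<in> A" "P \<subseteq> A" "P \<inter> nbrs E w = {}" "card {v \<in> P. x w < x v} < h" by auto
qed

lemma sum_nbrs:
  assumes "simple_graph n E"
  shows "(\<Sum>u\<in>nbrs E v. g u) = (\<Sum>u<n. if u \<in> nbrs E v then g u else 0)"
proof -
  have "nbrs E v = {u \<in> {..<n}. u \<in> nbrs E v}" using nbrs_subset[OF assms] by auto
  then show ?thesis using sum.inter_filter[of "{..<n}" g "\<lambda>u. u \<in> nbrs E v"] by simp
qed

text \<open>With entries of mean 1, the parts satisfy the hypotheses of
  \<open>balanced_weights\<close>, so all but a few entries are at most \<open>1 + 12 * s\<close>.
  Summing the eigenvector inequality over all vertices bounds \<open>q * n / 2\<close> by the degree
  sum weighted with \<open>x\<close>, and the weights can then be dropped at small cost.\<close>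

lemma spectral_degree_sum_normalised:
  fixes x :: "nat \<Rightarrow> real"
  assumes k: "k \<ge> 3" and E: "simple_graph n E" and n: "n > 0"
    and s: "0 < s" "s \<le> 1" and e: "18 * real k * e = s\<^sup>2"
    and x0: "\<And>v. 0 \<le> x v" and sumx: "(\<Sum>v<n. x v) = real n"
    and x: "\<And>v. v < n \<Longrightarrow> 2 * (1 - 1 / real k - e / 4) * real n * x v \<le> real (degree E v) * x v + (\<Sum>u\<in>nbrs E v. x u)"
    and greedy: "greedy E (\<lambda>_. x) h {..<n} ps" "length ps \<le> k" and h: "real h \<le> e / 24 * real n"
  shows "(1 - 1 / real k - 13 * s) * (real n)\<^sup>2 \<le> (\<Sum>v<n. real (degree E v))"
proof -
  define \<gamma> where "\<gamma> = 1 - 2 / real k"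
  define q where "q = 2 * (1 - 1 / real k - e / 4) * real n"
  have kr: "real k \<ge> 3" using k by simp
  have \<gamma>: "1 / 3 \<le> \<gamma>" "\<gamma> \<le> 1" using kr by (auto simp: \<gamma>_def field_simps)
  have nr: "real n > 0" using n by simp
  have s2: "s\<^sup>2 \<le> s" using s by (simp add: power2_eq_square mult_left_le)
  have "0 < real k * e" using e s by (metis mult.assoc zero_less_mult_iff zero_less_numeral zero_less_power not_numeral_less_zero)
  then have e0: "0 < e" using kr by (simp add: zero_less_mult_iff)
  have ke: "real k * e \<le> s / 18" using e s2 by simp
  have "3 * e \<le> real k * e" using kr e0 by (intro mult_right_mono) auto
  with ke s have e1: "e \<le> 1 / 54" by simp
  have q: "q = (1 + \<gamma> - e / 2) * real n" by (simp add: q_def \<gamma>_def)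
  have fin: "finite (nbrs E v)" for v using nbrs_subset[OF E] finite_subset by blast
  have degn: "degree E v \<le> n" for v
    using card_mono[OF _ nbrs_subset[OF E], of v] by (simp add: degree_eq_card_nbrs)
  have nb_le: "(\<Sum>u\<in>nbrs E v. x u) \<le> real n" for v
    unfolding sumx[symmetric] using nbrs_subset[OF E] x0 by (intro sum_mono2) auto
  \<comment> \<open>No entry is much larger than average, because \<open>q - n\<close> is of order \<open>n\<close>; this fails for \<open>k = 2\<close>.\<close>
  have x6: "x v \<le> 6" if "v < n" for v
  proof -
    have "q * x v \<le> real n * x v + real n"
      using x[OF that] nb_le[of v] mult_right_mono[of "real (degree E v)" "real n" "x v"] degn[of v] x0[of v]
      unfolding q_def by simp
    then have "(\<gamma> - e / 2) * x v * real n \<le> 1 * real n" unfolding q by (simp add: algebra_simps)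
    then have "(\<gamma> - e / 2) * x v \<le> 1" using nr by (simp only: mult_le_cancel_right_pos)
    moreover have "1 / 6 * x v \<le> (\<gamma> - e / 2) * x v" using \<gamma> e1 x0 by (intro mult_right_mono) auto
    ultimately show ?thesis by simp
  qed
  obtain R where R: "R \<subseteq> {..<n}" "card R < h"
    "\<And>g::nat \<Rightarrow> real. sum g {..<n} = (\<Sum>p\<leftarrow>ps. sum g (snd p)) + sum g R"
    using greedy_exhausts[OF greedy(1)] by auto
  have hR: "real (card R) \<le> e / 24 * real n" using R(2) h by simp
  have R': "sum g {..<n} = (\<Sum>i<k. sum g (part ps i)) + sum g R" for g :: "nat \<Rightarrow> real"
    using R(3)[of g] sum_part[OF greedy(2), of "sum g"] by simp
  define \<alpha> where "\<alpha> i = real (card (part ps i)) / real n" for i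
  define \<beta> where "\<beta> i = sum x (part ps i) / real n" for i
  \<comment> \<open>The default 0 makes the estimates below trivial for a padded empty part.\<close>
  define a where "a i = (if i < length ps then x (fst (ps ! i)) else 0)" for i
  have Psub: "part ps i \<subseteq> {..<n}" for i
  proof (cases "i < length ps")
    case True
    then have "(fst (ps ! i), part ps i) \<in> set ps" by (simp add: part_def)
    from greedy_part(2)[OF greedy(1) _ this] show ?thesis by simp
  qed (simp add: part_def)
  have finP: "finite (part ps i)" for i using Psub finite_subset by blast
  have \<alpha>01: "0 \<le> \<alpha> i" "\<alpha> i \<le> 1" for i
    using card_mono[OF _ Psub[of i]] nr by (auto simp: \<alpha>_def)
  have \<beta>1: "\<beta> i \<le> 1" for i
    using sum_mono2[of "{..<n}" "part ps i" x] Psub[of i] x0 nr sumx by (auto simp: \<beta>_def)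
  have dom: "card {v \<in> part ps i. a i < x v} \<le> h" for i
  proof (cases "i < length ps")
    case True
    then have "(fst (ps ! i), part ps i) \<in> set ps" by (simp add: part_def)
    from greedy_part(4)[OF greedy(1) _ this] True show ?thesis by (simp add: a_def)
  qed (simp add: part_def)
  \<comment> \<open>The chosen vertex has all its neighbours outside its part, so its degree is at
    most \<open>n - card P\<close> and the entries over its neighbours sum to at most
    \<open>n - sum x P\<close>.\<close>
  have a\<beta>: "a i * (\<gamma> - e / 2 + \<alpha> i) \<le> 1 - \<beta> i" for i
  proof (cases "i < length ps")
    case True
    define w where "w = fst (ps ! i)"
    define P where "P = part ps i"
    have "(w, P) \<in> set ps" using True by (simp add: part_def w_def P_def)
    note wP = greedy_part[OF greedy(1) _ this, simplified]
    have sub: "nbrs E w \<subseteq> {..<n} - P" using wP(3) nbrs_subset[OF E] by auto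
    have "card (nbrs E w) \<le> card ({..<n} - P)" using sub by (intro card_mono) auto
    also have "\<dots> = n - card P" using finP Psub by (subst card_Diff_subset) (auto simp: P_def)
    finally have "real (degree E w) \<le> real n - real (card P)"
      using card_mono[OF _ Psub[of i]] by (simp add: degree_eq_card_nbrs P_def of_nat_diff)
    then have "real (degree E w) * x w \<le> (real n - real (card P)) * x w" using x0 by (intro mult_right_mono)
    moreover have "(\<Sum>u\<in>nbrs E w. x u) \<le> real n - sum x P"
    proof -
      have "(\<Sum>u\<in>nbrs E w. x u) \<le> sum x ({..<n} - P)" using sub x0 by (intro sum_mono2) auto
      also have "\<dots> = real n - sum x P" using finP Psub sumx by (subst sum_diff) (auto simp: P_def)
      finally show ?thesis .
    qed
    ultimately have "q * x w \<le> (real n - real (card P)) * x w + (real n - sum x P)"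
      using x[OF wP(1)] unfolding q_def by linarith
    then have "x w * ((\<gamma> - e / 2) * real n + real (card P)) \<le> real n - sum x P"
      unfolding q by (simp add: algebra_simps)
    then have "(x w * ((\<gamma> - e / 2) * real n + real (card P))) / real n \<le> (real n - sum x P) / real n"
      using nr by (intro divide_right_mono) auto
    then show ?thesis using True nr
      by (simp add: a_def \<alpha>_def \<beta>_def w_def P_def add_divide_distrib diff_divide_distrib)
        (simp add: field_simps)
  next
    case False
    then show ?thesis by (simp add: a_def \<beta>_def part_def)
  qed
  \<comment> \<open>At most \<open>h\<close> vertices of the part exceed \<open>a i\<close>, each
    with entry at most 6; this gives the error \<open>e / 4\<close>.\<close>
  have \<beta>a: "\<beta> i \<le> \<alpha> i * a i + e / 4" for i
  proof -
    have "sum x (part ps i) \<le> (\<Sum>v\<in>part ps i. a i + (if a i < x v then 6 else 0))"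
    proof (rule sum_mono)
      fix v assume "v \<in> part ps i"
      then have "x v \<le> 6" using Psub x6 by auto
      moreover have "0 \<le> a i" using x0 by (simp add: a_def)
      ultimately show "x v \<le> a i + (if a i < x v then 6 else 0)" by auto
    qed
    also have "\<dots> = real (card (part ps i)) * a i + 6 * real (card {v \<in> part ps i. a i < x v})"
      using finP by (simp add: sum.distrib sum.inter_filter[symmetric])
    also have "\<dots> \<le> real (card (part ps i)) * a i + e / 4 * real n" using dom[of i] h by simp
    finally have "sum x (part ps i) / real n \<le> (real (card (part ps i)) * a i + e / 4 * real n) / real n"
      using nr by (intro divide_right_mono) auto
    then show ?thesis using nr by (simp add: \<alpha>_def \<beta>_def add_divide_distrib)
  qed
  have a6: "0 \<le> a i \<and> a i \<le> 6" for i
    using greedy_part(1)[OF greedy(1), of "fst (ps ! i)" "snd (ps ! i)"] nth_mem[of i ps] x6 x0 by (auto simp: a_def)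
  have main: "a i \<le> 1 + 12 * s" if "i < k" for i
  proof (rule balanced_weights[OF k less_imp_le[OF s(1)] s(2) e, of \<alpha> a \<beta>, folded \<gamma>_def])
    fix i
    show "\<beta> i * (\<gamma> + 2 * \<alpha> i) \<le> \<alpha> i + e"
    proof -
      \<comment> \<open>\<open>a i\<close> is eliminated between the two estimates; moving
        \<open>\<alpha> i * \<beta> i\<close> to the left produces the
        \<open>2 * \<alpha> i\<close>.\<close>
      have "\<beta> i * (\<gamma> - e / 2 + \<alpha> i) \<le> (\<alpha> i * a i + e / 4) * (\<gamma> - e / 2 + \<alpha> i)"
        using \<beta>a[of i] \<gamma> e1 \<alpha>01 by (intro mult_right_mono) auto
      also have "\<dots> = \<alpha> i * (a i * (\<gamma> - e / 2 + \<alpha> i)) + e / 4 * (\<gamma> - e / 2 + \<alpha> i)" by (simp add: algebra_simps)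
      also have "\<dots> \<le> \<alpha> i * (1 - \<beta> i) + e / 4 * 2"
        using a\<beta>[of i] \<alpha>01[of i] \<gamma> e0 by (intro add_mono mult_left_mono) auto
      finally have "\<beta> i * (\<gamma> + 2 * \<alpha> i) \<le> \<alpha> i + e / 2 + e / 2 * \<beta> i" by (simp add: algebra_simps)
      also have "e / 2 * \<beta> i \<le> e / 2 * 1" using \<beta>1 e0 by (intro mult_left_mono) auto
      finally show ?thesis by simp
    qed
    have "a i * (e / 2) \<le> 6 * (e / 2)" using a6[of i] e0 by (intro mult_right_mono) auto
    moreover have "a i * (\<gamma> + \<alpha> i) = a i * (\<gamma> - e / 2 + \<alpha> i) + a i * (e / 2)" by (simp add: algebra_simps)
    ultimately show "a i * (\<gamma> + \<alpha> i) \<le> 1 - \<beta> i + 6 * e" using a\<beta>[of i] e0 by linarith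
  next
    have "(\<Sum>i<k. real (card (part ps i))) \<le> real n" using R'[of "\<lambda>_. 1"] by simp
    then show "(\<Sum>i<k. \<alpha> i) \<le> 1" using nr by (simp add: \<alpha>_def sum_divide_distrib[symmetric])
    have "sum x R \<le> (\<Sum>v\<in>R. 6)" using R(1) x6 by (intro sum_mono) auto
    also have "\<dots> \<le> e * real n" using hR e0 nr mult_pos_pos[of e "real n"] by simp
    finally have "(1 - e) * real n \<le> (\<Sum>i<k. sum x (part ps i))" using R'[of x] sumx by (simp add: algebra_simps)
    then show "1 - e \<le> (\<Sum>i<k. \<beta> i)" using nr by (simp add: \<beta>_def sum_divide_distrib[symmetric] field_simps)
  qed (use \<alpha>01 a6 that in auto)
  define H where "H = {v. v < n \<and> 1 + 12 * s < x v}"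
  \<comment> \<open>By \<open>main\<close> an entry above \<open>1 + 12 * s\<close> also exceeds the
    \<open>a i\<close> of its part, so each part holds at most \<open>h\<close> of them; the extra
    \<open>h\<close> is for the leftover \<open>R\<close>.\<close>
  have cardH: "real (card H) \<le> (real k + 1) * real h"
  proof -
    have "real (card H) = (\<Sum>v<n. if 1 + 12 * s < x v then 1 else 0)"
      by (simp add: H_def sum.inter_filter[symmetric])
    also have "\<dots> = (\<Sum>i<k. \<Sum>v\<in>part ps i. if 1 + 12 * s < x v then 1 else 0) + (\<Sum>v\<in>R. if 1 + 12 * s < x v then 1 else 0)"
      by (rule R')
    also have "\<dots> \<le> (\<Sum>i<k. real h) + real h"
    proof (intro add_mono sum_mono)
      fix i assume "i \<in> {..<k}"
      then have "card {v \<in> part ps i. 1 + 12 * s < x v} \<le> card {v \<in> part ps i. a i < x v}"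
        using finP main by (intro card_mono) fastforce+
      with dom[of i] show "(\<Sum>v\<in>part ps i. if 1 + 12 * s < x v then 1 else 0) \<le> real h"
        using finP by (simp add: sum.inter_filter[symmetric])
    next
      have "(\<Sum>v\<in>R. if 1 + 12 * s < x v then 1 else 0) \<le> (\<Sum>v\<in>R. 1::real)" by (intro sum_mono) auto
      then show "(\<Sum>v\<in>R. if 1 + 12 * s < x v then 1 else 0) \<le> real h" using R(2) by simp
    qed
    finally show ?thesis by (simp add: algebra_simps)
  qed
  have "q * real n = (\<Sum>v<n. q * x v)" by (simp add: sumx flip: sum_distrib_left)
  also have "\<dots> \<le> (\<Sum>v<n. real (degree E v) * x v + (\<Sum>u\<in>nbrs E v. x u))"
    using x by (intro sum_mono) (simp add: q_def)
  also have "(\<Sum>v<n. real (degree E v) * x v + (\<Sum>u\<in>nbrs E v. x u))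
      = (\<Sum>v<n. real (degree E v) * x v) + (\<Sum>v<n. \<Sum>u\<in>nbrs E v. x u)" by (rule sum.distrib)
  also have "(\<Sum>v<n. \<Sum>u\<in>nbrs E v. x u) = (\<Sum>v<n. \<Sum>u<n. if u \<in> nbrs E v then x u else 0)"
    by (simp only: sum_nbrs[OF E])
  also have "\<dots> = (\<Sum>u<n. \<Sum>v<n. if v \<in> nbrs E u then x u else 0)"
    by (subst sum.swap) (simp only: nbrs_sym)
  also have "\<dots> = (\<Sum>u<n. real (degree E u) * x u)"
    by (simp only: sum_nbrs[OF E, symmetric]) (simp add: degree_eq_card_nbrs)
  finally have "q * real n / 2 \<le> (\<Sum>v<n. real (degree E v) * x v)" by simp
  also have "\<dots> \<le> (\<Sum>v<n. real (degree E v) + (12 * s * real n + (if v \<in> H then 6 * real n else 0)))"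
  proof (rule sum_mono)
    fix v assume v: "v \<in> {..<n}"
    have "real (degree E v) * x v \<le> real (degree E v) * ((1 + 12 * s) + (if v \<in> H then 6 else 0))"
      using v x6[of v] s by (intro mult_left_mono) (auto simp: H_def)
    also have "\<dots> = real (degree E v) + real (degree E v) * (12 * s + (if v \<in> H then 6 else 0))" by (simp add: algebra_simps)
    also have "\<dots> \<le> real (degree E v) + real n * (12 * s + (if v \<in> H then 6 else 0))"
      using degn[of v] s by (intro add_mono mult_right_mono) auto
    finally show "real (degree E v) * x v \<le> real (degree E v) + (12 * s * real n + (if v \<in> H then 6 * real n else 0))"
      by (simp add: algebra_simps split: if_splits)
  qed
  also have "\<dots> = (\<Sum>v<n. real (degree E v)) + 12 * s * (real n)\<^sup>2 + 6 * real n * real (card H)"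
    by (simp add: sum.distrib power2_eq_square H_def sum.inter_filter[symmetric])
  finally have fin1: "q * real n / 2 \<le> (\<Sum>v<n. real (degree E v)) + 12 * s * (real n)\<^sup>2 + 6 * real n * real (card H)" .
  have "6 * real n * real (card H) \<le> 6 * real n * ((real k + 1) * (e / 24 * real n))"
    using cardH h by (intro mult_left_mono order_trans[OF cardH]) auto
  also have "\<dots> = ((real k * e + e) / 4) * (real n)\<^sup>2" by (simp add: power2_eq_square algebra_simps)
  finally have "q * real n / 2 - 12 * s * (real n)\<^sup>2 - ((real k * e + e) / 4) * (real n)\<^sup>2 \<le> (\<Sum>v<n. real (degree E v))"
    using fin1 by linarith
  moreover have "q * real n / 2 = (1 - 1 / real k - e / 4) * (real n)\<^sup>2" by (simp add: q_def power2_eq_square)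
  ultimately have "((1 - 1 / real k - e / 4) - 12 * s - (real k * e + e) / 4) * (real n)\<^sup>2 \<le> (\<Sum>v<n. real (degree E v))"
    by (simp add: algebra_simps)
  moreover have "e / 4 + (real k * e + e) / 4 \<le> s"
  proof -
    define d where "d = real k * e"
    show ?thesis using ke \<open>3 * e \<le> real k * e\<close> s unfolding d_def[symmetric] by (simp add: field_simps)
  qed
  then have "1 - 1 / real k - 13 * s \<le> (1 - 1 / real k - e / 4) - 12 * s - (real k * e + e) / 4"
    by linarith
  then have "(1 - 1 / real k - 13 * s) * (real n)\<^sup>2 \<le> ((1 - 1 / real k - e / 4) - 12 * s - (real k * e + e) / 4) * (real n)\<^sup>2"
    by (intro mult_right_mono) auto
  ultimately show ?thesis by linarith
qed

text \<open>A greedy run only compares scores, so it survives the rescaling of \<open>x\<close> to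
  total \<open>n\<close>.\<close>

lemma spectral_degree_sum:
  fixes x :: "nat \<Rightarrow> real"
  assumes "k \<ge> 3" "simple_graph n E" "n > 0"
    and "0 < s" "s \<le> 1" "18 * real k * e = s\<^sup>2"
    and x0: "\<And>v. 0 \<le> x v" "\<exists>v<n. x v \<noteq> 0"
    and x: "\<And>v. v < n \<Longrightarrow> 2 * (1 - 1 / real k - e / 4) * real n * x v \<le> real (degree E v) * x v + (\<Sum>u\<in>nbrs E v. x u)"
    and greedy: "greedy E (\<lambda>_. x) h {..<n} ps" "length ps \<le> k" and h: "real h \<le> e / 24 * real n"
  shows "(1 - 1 / real k - 13 * s) * (real n)\<^sup>2 \<le> (\<Sum>v<n. real (degree E v))"
proof -
  define X where "X = (\<Sum>v<n. x v)"
  have "X \<noteq> 0" using x0 unfolding X_def by (subst sum_nonneg_eq_0_iff) auto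
  moreover have "X \<ge> 0" using x0 unfolding X_def by (intro sum_nonneg) auto
  ultimately have X: "X > 0" by simp
  define c where "c = real n / X"
  have c: "c > 0" using X assms(3) by (simp add: c_def)
  have gr: "greedy E (\<lambda>_ v. c * x v) h A ps" if "greedy E (\<lambda>_. x) h A ps" for A ps
    using that by induction (auto intro!: greedy.intros simp: c)
  show ?thesis
  proof (rule spectral_degree_sum_normalised[OF assms(1-6), of "\<lambda>v. c * x v"])
    have "(\<Sum>v<n. c * x v) = c * X" by (simp add: X_def sum_distrib_left)
    then show "(\<Sum>v<n. c * x v) = real n" using X by (simp add: c_def)
    show "greedy E (\<lambda>_ v. c * x v) h {..<n} ps" using gr greedy(1) .
    fix v assume "v < n"
    from mult_left_mono[OF x[OF this] less_imp_le[OF c]]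
    show "2 * (1 - 1 / real k - e / 4) * real n * (c * x v) \<le> real (degree E v) * (c * x v) + (\<Sum>u\<in>nbrs E v. c * x u)"
      by (simp add: algebra_simps sum_distrib_left)
  qed (use c x0 greedy(2) h in auto)
qed

section \<open>Stability\<close>

text \<open>Counts adjacent pairs, adjacent monochromatic pairs and monochromatic pairs at once, because the
  greedy step bounds exactly the sum of these three numbers.\<close>
definition pair_weight :: "nat set set \<Rightarrow> (nat \<Rightarrow> nat) \<Rightarrow> nat \<Rightarrow> nat \<Rightarrow> nat" where
  "pair_weight E c u v = of_bool (v \<in> nbrs E u) + of_bool (v \<in> nbrs E u \<and> c u = c v) + of_bool (c u = c v)"

lemma pair_weight_commute: "pair_weight E c u v = pair_weight E c v u"
  unfolding pair_weight_def nbrs_sym[of u E v] by (cases "c u = c v") auto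

text \<open>Each part gets its own colour. As \<open>w\<close> has \<open>card B\<close> neighbours
  in \<open>A\<close> and almost maximal degree there, the degrees of \<open>P\<close> inside
  \<open>A\<close> sum to at most about \<open>card P * card B\<close>. Twice this, plus the
  \<open>(card P)\<^sup>2\<close> monochromatic pairs in \<open>P\<close> and the inductive
  \<open>(card B)\<^sup>2\<close>, makes \<open>(card A)\<^sup>2\<close>.\<close>

lemma greedy_colouring:
  assumes "greedy E (\<lambda>A v. real (card (A \<inter> nbrs E v))) h A ps" "finite A" "card A \<le> N"
  shows "\<exists>c. (\<forall>v. c v < max 1 (length ps)) \<and>
    (\<Sum>u\<in>A. \<Sum>v\<in>A. pair_weight E c u v) \<le> (card A)\<^sup>2 + (6 * length ps + 2) * (h * N)"
  using assms
proof induction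
  case (stop A)
  \<comment> \<open>The leftover set gets colour 0 even if there is no part, hence the
    \<open>max 1\<close>. It has fewer than \<open>h\<close> vertices, so weight 3 per pair is
    affordable.\<close>
  have "(\<Sum>u\<in>A. \<Sum>v\<in>A. pair_weight E (\<lambda>_. 0) u v) \<le> (\<Sum>u\<in>A. \<Sum>v\<in>A. 3)"
    by (intro sum_mono) (simp add: pair_weight_def)
  also have "\<dots> = (card A)\<^sup>2 + 2 * (card A * card A)" by (simp add: power2_eq_square)
  also have "card A * card A \<le> h * N" using stop by (intro mult_mono) auto
  finally show ?case by (intro exI[of _ "\<lambda>_. 0"]) simp
next
  case (step w A ps)
  define B where "B = A \<inter> nbrs E w"
  define P where "P = A - nbrs E w"
  have fin: "finite B" "finite P" using step.prems by (auto simp: B_def P_def)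
  have A: "A = P \<union> B" "P \<inter> B = {}" by (auto simp: B_def P_def)
  have cardA: "card A = card P + card B" using fin A by (simp add: card_Un_disjoint)
  define L where "L = length ps"
  obtain c where c: "\<forall>v. c v < max 1 L"
    and cB: "(\<Sum>u\<in>B. \<Sum>v\<in>B. pair_weight E c u v) \<le> (card B)\<^sup>2 + (6 * L + 2) * (h * N)"
    using step.IH step.prems fin cardA unfolding B_def[symmetric] L_def by auto
  define c' where "c' v = (if v \<in> P then L else c v)" for v
  define F where "F X Y = (\<Sum>u\<in>X. \<Sum>v\<in>Y. pair_weight E c' u v)" for X Y
  define T where "T X Y = (\<Sum>u\<in>X. card (Y \<inter> nbrs E u))" for X Y
  have F_sym: "F X Y = F Y X" for X Y
    unfolding F_def by (subst sum.swap) (simp only: pair_weight_commute)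
  have card_nbrs: "card (Y \<inter> nbrs E u) = (\<Sum>v\<in>Y. of_bool (v \<in> nbrs E u))" if "finite Y" for Y u
    using that by (simp add: Int_def)
  have "F A A = F P P + F P B + (F B P + F B B)"
    unfolding F_def using fin A(2) by (subst (1 2) A(1)) (simp add: sum.union_disjoint sum.distrib)
  then have FA: "F A A = F P P + 2 * F P B + F B B" using F_sym[of B P] by simp
  have FBB: "F B B \<le> (card B)\<^sup>2 + (6 * L + 2) * (h * N)"
  proof -
    have "F B B = (\<Sum>u\<in>B. \<Sum>v\<in>B. pair_weight E c u v)"
      unfolding F_def using A(2) by (intro sum.cong refl) (auto simp: pair_weight_def c'_def)
    with cB show ?thesis by simp
  qed
  have FPP: "F P P = 2 * T P P + (card P)\<^sup>2"
  proof -
    have "(\<Sum>v\<in>P. 2 * of_bool (v \<in> nbrs E u) + 1) = 2 * card (P \<inter> nbrs E u) + card P" for u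
      by (simp only: sum.distrib card_nbrs[OF fin(2)] sum_distrib_left[symmetric]) simp
    moreover have "F P P = (\<Sum>u\<in>P. \<Sum>v\<in>P. 2 * of_bool (v \<in> nbrs E u) + 1)"
      unfolding F_def by (intro sum.cong refl) (simp add: pair_weight_def c'_def)
    ultimately have "F P P = 2 * T P P + (card P)\<^sup>2"
      by (simp only: T_def sum.distrib sum_distrib_left[symmetric]) (simp add: power2_eq_square)
    then show ?thesis .
  qed
  \<comment> \<open>The colour \<open>L\<close> is new unless \<open>L = 0\<close>; in that case all
    of \<open>B\<close> already has colour 0, but \<open>B\<close> is leftover and has fewer than
    \<open>h\<close> vertices.\<close>
  have cL: "card {v \<in> B. c v = L} \<le> h"
  proof (cases ps)
    case Nil
    then have "card B < h" using step.hyps(3) by (auto simp: B_def elim: greedy.cases)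
    moreover have "card {v \<in> B. c v = L} \<le> card B" using fin by (intro card_mono) auto
    ultimately show ?thesis by simp
  next
    case Cons
    then have "c v \<noteq> L" for v using c[rule_format, of v] by (simp add: L_def)
    then show ?thesis by simp
  qed
  have FPB: "F P B \<le> T P B + 2 * (h * N)"
  proof -
    have "F P B \<le> (\<Sum>u\<in>P. card (B \<inter> nbrs E u) + 2 * h)"
      unfolding F_def
    proof (rule sum_mono)
      fix u assume u: "u \<in> P"
      have "(\<Sum>v\<in>B. pair_weight E c' u v) \<le> (\<Sum>v\<in>B. of_bool (v \<in> nbrs E u) + 2 * of_bool (c v = L))"
        using u A(2) by (intro sum_mono) (auto simp: pair_weight_def c'_def)
      also have "\<dots> = card (B \<inter> nbrs E u) + 2 * (\<Sum>v\<in>B. of_bool (c v = L))"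
        by (simp add: card_nbrs[OF fin(1)] sum.distrib sum_distrib_left del: sum_of_bool_eq)
      also have "(\<Sum>v\<in>B. of_bool (c v = L)) = card {v \<in> B. c v = L}" using fin by (simp add: Int_def)
      finally show "(\<Sum>v\<in>B. pair_weight E c' u v) \<le> card (B \<inter> nbrs E u) + 2 * h" using cL by simp
    qed
    also have "\<dots> = T P B + 2 * (h * card P)" by (simp add: T_def sum.distrib)
    also have "h * card P \<le> h * N" using step.prems cardA by (intro mult_left_mono) auto
    finally show ?thesis by simp
  qed
  have TP: "T P P + T P B \<le> card P * card B + h * N"
  proof -
    have "T P P + T P B = (\<Sum>u\<in>P. card (A \<inter> nbrs E u))"
    proof -
      have "card (P \<inter> nbrs E u) + card (B \<inter> nbrs E u) = card (A \<inter> nbrs E u)" for u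
        using fin A by (subst card_Un_disjoint[symmetric]) (auto simp: Int_Un_distrib2)
      then show ?thesis by (simp add: T_def flip: sum.distrib)
    qed
    \<comment> \<open>Each of the fewer than \<open>h\<close> vertices that beat \<open>w\<close>
      costs at most \<open>N\<close>.\<close>
    also have "\<dots> \<le> (\<Sum>u\<in>P. card B + (if card B < card (A \<inter> nbrs E u) then N else 0))"
    proof (rule sum_mono)
      fix u
      have "card (A \<inter> nbrs E u) \<le> card A" using step.prems by (intro card_mono) auto
      then show "card (A \<inter> nbrs E u) \<le> card B + (if card B < card (A \<inter> nbrs E u) then N else 0)"
        using step.prems by simp
    qed
    also have "\<dots> = card P * card B + N * card {u \<in> P. card B < card (A \<inter> nbrs E u)}"
      using fin by (simp add: sum.distrib sum.inter_filter[symmetric])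
    also have "card {u \<in> P. card B < card (A \<inter> nbrs E u)} \<le> card {u \<in> A. card B < card (A \<inter> nbrs E u)}"
      using step.prems A by (intro card_mono) auto
    also have "\<dots> \<le> h" using step.hyps(2) by (simp add: B_def)
    finally show ?thesis by (simp add: mult.commute)
  qed
  have "F A A \<le> 2 * (card P * card B + h * N) + (card P)\<^sup>2 + 4 * (h * N) + ((card B)\<^sup>2 + (6 * L + 2) * (h * N))"
  proof -
    define Z where "Z = h * N"
    define Y where "Y = card P * card B"
    define K where "K = (6 * L + 2) * Z"
    show ?thesis
      using FA FPP FPB FBB TP unfolding Z_def[symmetric] Y_def[symmetric] K_def[symmetric] by (simp add: algebra_simps)
  qed
  also have "\<dots> = (card A)\<^sup>2 + (6 * Suc L + 2) * (h * N)"
    by (simp add: cardA power2_eq_square algebra_simps)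
  finally have "F A A \<le> (card A)\<^sup>2 + (6 * length ((w, A - nbrs E w) # ps) + 2) * (h * N)" by (simp add: L_def)
  moreover have "\<forall>v. c' v < max 1 (length ((w, A - nbrs E w) # ps))"
    using c by (auto simp: c'_def L_def max_def less_Suc_eq split: if_splits)
  ultimately show ?case unfolding F_def by blast
qed

text \<open>Classes of equal colour are matched as far as their sizes allow; at most
  \<open>z\<close> vertices per class of \<open>t\<close> remain, and these are matched
  arbitrarily.\<close>

lemma bij_matching_classes:
  fixes t c :: "nat \<Rightarrow> nat"
  assumes t: "\<And>v. v < n \<Longrightarrow> t v < k" and c: "\<And>v. v < n \<Longrightarrow> c v < k"
    and z: "\<And>j. j < k \<Longrightarrow> card {v. v < n \<and> t v = j} \<le> card {v. v < n \<and> c v = j} + z"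
  shows "\<exists>\<pi>. bij_betw \<pi> {..<n} {..<n} \<and> card {v. v < n \<and> c (\<pi> v) \<noteq> t v} \<le> k * z"
proof -
  define T where "T j = {v. v < n \<and> t v = j}" for j
  define C where "C j = {v. v < n \<and> c v = j}" for j
  define M where "M j = min (card (T j)) (card (C j))" for j
  have finT: "finite (T j)" and finC: "finite (C j)" for j by (auto simp: T_def C_def)
  have "\<exists>D. D \<subseteq> T j \<and> card D = M j" for j
    using obtain_subset_with_card_n[of "M j" "T j"] unfolding M_def by auto
  then obtain D where D: "\<And>j. D j \<subseteq> T j" "\<And>j. card (D j) = M j" by metis
  have "\<exists>D. D \<subseteq> C j \<and> card D = M j" for j
    using obtain_subset_with_card_n[of "M j" "C j"] unfolding M_def by auto
  then obtain D' where D': "\<And>j. D' j \<subseteq> C j" "\<And>j. card (D' j) = M j" by metis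
  have DT: "v < n" "t v = j" if "v \<in> D j" for v j using D(1)[of j] that by (auto simp: T_def)
  have DC: "v < n" "c v = j" if "v \<in> D' j" for v j using D'(1)[of j] that by (auto simp: C_def)
  have finD: "finite (D j)" "finite (D' j)" for j
    using finite_subset[OF D(1) finT] finite_subset[OF D'(1) finC] by auto
  have "\<exists>g. bij_betw g (D j) (D' j)" for j
    using finD D(2) D'(2) by (intro finite_same_card_bij) auto
  then obtain g where g: "\<And>j. bij_betw (g j) (D j) (D' j)" by metis
  define G where "G v = g (t v) v" for v
  have G: "bij_betw G (D j) (D' j)" for j
    using g[of j] D(1)[of j] by (subst bij_betw_cong[of _ _ "g j"]) (auto simp: G_def T_def)
  define DD where "DD = (\<Union>j<k. D j)"
  define DD' where "DD' = (\<Union>j<k. D' j)"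
  have bijG: "bij_betw G DD DD'" unfolding DD_def DD'_def
  proof (rule bij_betw_UNION_disjoint)
    show "disjoint_family_on D' {..<k}" unfolding disjoint_family_on_def using DC(2) by blast
  qed (rule G)
  have sub: "DD \<subseteq> {..<n}" "DD' \<subseteq> {..<n}" using DT(1) DC(1) unfolding DD_def DD'_def by auto
  have finDD: "finite DD" "finite DD'" using finite_subset[OF sub(1)] finite_subset[OF sub(2)] by auto
  have "card ({..<n} - DD) = card ({..<n} - DD')"
    using bij_betw_same_card[OF bijG] sub finDD by (simp add: card_Diff_subset)
  then obtain f where f: "bij_betw f ({..<n} - DD) ({..<n} - DD')"
    using finite_same_card_bij[of "{..<n} - DD" "{..<n} - DD'"] by auto
  define \<pi> where "\<pi> v = (if v \<in> DD then G v else f v)" for v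
  have "bij_betw \<pi> DD DD'" using bijG by (subst bij_betw_cong[of _ _ G]) (auto simp: \<pi>_def)
  moreover have "bij_betw \<pi> ({..<n} - DD) ({..<n} - DD')"
    using f by (subst bij_betw_cong[of _ _ f]) (auto simp: \<pi>_def)
  ultimately have "bij_betw \<pi> (DD \<union> ({..<n} - DD)) (DD' \<union> ({..<n} - DD'))"
    by (rule bij_betw_combine) auto
  then have bij: "bij_betw \<pi> {..<n} {..<n}" using sub by (simp add: Un_absorb1)
  have good: "c (\<pi> v) = t v" if "v \<in> DD" for v
  proof -
    from that obtain j where j: "v \<in> D j" by (auto simp: DD_def)
    then have "G v \<in> D' j" using G[of j] by (auto simp: bij_betw_def)
    then show ?thesis using that DT(2)[OF j] DC(2)[of "G v" j] by (simp add: \<pi>_def)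
  qed
  have "card {v. v < n \<and> c (\<pi> v) \<noteq> t v} \<le> card ({..<n} - DD)"
    using good by (intro card_mono) auto
  also have "\<dots> = n - card DD" using sub finDD by (simp add: card_Diff_subset)
  also have "\<dots> \<le> k * z"
  proof -
    have "card DD = (\<Sum>j<k. card (D j))" unfolding DD_def
      by (rule card_UN_disjoint) (use finD DT(2) in \<open>simp_all, blast\<close>)
    moreover have "n = (\<Sum>j<k. card (T j))"
    proof -
      have "{..<n} = (\<Union>j<k. T j)" using t by (auto simp: T_def)
      then have "card {..<n} = card (\<Union>j<k. T j)" by (rule arg_cong)
      also have "\<dots> = (\<Sum>j<k. card (T j))" by (rule card_UN_disjoint) (auto simp: T_def)
      finally show ?thesis by simp
    qed
    moreover have "(\<Sum>j<k. card (T j)) \<le> (\<Sum>j<k. card (D j) + z)"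
      using z by (intro sum_mono) (auto simp: D(2) M_def T_def C_def min_def)
    ultimately show ?thesis by (simp add: sum.distrib)
  qed
  finally show ?thesis using bij by blast
qed

lemma card_residue_class_le:
  fixes k :: nat
  assumes "k > 0"
  shows "real (card {v. v < n \<and> v mod k = j}) \<le> real n / real k + 1"
proof -
  have "inj_on (\<lambda>v. v div k) {v. v < n \<and> v mod k = j}"
  proof (rule inj_onI)
    fix a b assume "a \<in> {v. v < n \<and> v mod k = j}" "b \<in> {v. v < n \<and> v mod k = j}" "a div k = b div k"
    then show "a = b" using div_mult_mod_eq[of a k] div_mult_mod_eq[of b k] by simp
  qed
  moreover have "(\<lambda>v. v div k) ` {v. v < n \<and> v mod k = j} \<subseteq> {..n div k}"
    by (auto intro: div_le_mono)
  ultimately have "card {v. v < n \<and> v mod k = j} \<le> card {..n div k}"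
    by (intro card_inj_on_le) auto
  then have "real (card {v. v < n \<and> v mod k = j}) \<le> real (n div k) + 1" by simp
  also have "real (n div k) \<le> real n / real k" by (rule of_nat_div_le_of_nat)
  finally show ?thesis by simp
qed

text \<open>Let \<open>T\<close>, \<open>S\<close>, \<open>Q\<close> count the adjacent, the
  adjacent monochromatic and the monochromatic ordered pairs. The upper bound on
  \<open>T + S + Q\<close>, the lower bound on \<open>T\<close> and
  \<open>Q \<ge> n\<^sup>2 / k\<close> leave little room: \<open>S\<close> is small and the class
  sizes have small variance.\<close>

lemma close_to_turan_if_colouring:
  fixes n k :: nat and r K L :: real
  assumes E: "simple_graph n E" and k: "k > 0" and c: "\<And>v. c v < k" and r: "r \<ge> 0"
    and KL: "0 \<le> K" "0 \<le> L" "K + L \<le> (r * real n)\<^sup>2"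
    and W: "real (\<Sum>u<n. \<Sum>v<n. pair_weight E c u v) \<le> (real n)\<^sup>2 + K"
    and deg: "(1 - 1 / real k) * (real n)\<^sup>2 - L \<le> (\<Sum>v<n. real (degree E v))"
  shows "close_to_turan n k E (3 * (r * real n)\<^sup>2 + real k * (r * real n + 2) * real n)"
proof -
  define C where "C j = {v. v < n \<and> c v = j}" for j
  define T where "T = (\<Sum>u<n. \<Sum>v<n. of_bool (v \<in> nbrs E u) :: real)"
  define S where "S = (\<Sum>u<n. \<Sum>v<n. of_bool (v \<in> nbrs E u \<and> c u = c v) :: real)"
  define Q where "Q = (\<Sum>u<n. \<Sum>v<n. of_bool (c u = c v) :: real)"
  have TSQ: "T + S + Q \<le> (real n)\<^sup>2 + K"
    using W by (simp only: T_def S_def Q_def pair_weight_def of_nat_sum of_nat_add of_nat_of_bool sum.distrib)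
  have S0: "0 \<le> S" unfolding S_def by (intro sum_nonneg) auto
  have nb: "{v. v < n \<and> v \<in> nbrs E u} = nbrs E u" for u using nbrs_subset[OF E, of u] by auto
  have T: "(1 - 1 / real k) * (real n)\<^sup>2 - L \<le> T"
  proof -
    have "T = (\<Sum>v<n. real (degree E v))"
      unfolding T_def degree_eq_card_nbrs
      by (intro sum.cong refl) (simp add: of_bool_def nb flip: sum.inter_filter)
    with deg show ?thesis by simp
  qed
  have Q_eq: "Q = (\<Sum>j<k. (real (card (C j)))\<^sup>2)"
  proof -
    have "Q = (\<Sum>u<n. real (card (C (c u))))"
    proof -
      have "{v \<in> {..<n}. c u = c v} = C (c u)" for u by (auto simp: C_def)
      then show ?thesis unfolding Q_def by (simp add: of_bool_def flip: sum.inter_filter)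
    qed
    also have "\<dots> = (\<Sum>j<k. \<Sum>u\<in>{u \<in> {..<n}. c u = j}. real (card (C (c u))))"
      by (rule sum.group[symmetric]) (use c in auto)
    also have "\<dots> = (\<Sum>j<k. \<Sum>u\<in>C j. real (card (C j)))"
      by (intro sum.cong refl) (auto simp: C_def)
    finally show ?thesis by (simp add: power2_eq_square)
  qed
  have sumC: "(\<Sum>j<k. real (card (C j))) = real n"
  proof -
    have "(\<Sum>j<k. \<Sum>u\<in>{u \<in> {..<n}. c u = j}. 1) = (\<Sum>u<n. 1::real)"
      by (rule sum.group) (use c in auto)
    moreover have "{u \<in> {..<n}. c u = j} = C j" for j by (auto simp: C_def)
    ultimately show ?thesis by simp
  qed
  have var: "(\<Sum>j<k. (real (card (C j)) - real n / real k)\<^sup>2) = Q - (real n)\<^sup>2 / real k"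
  proof -
    have "(\<Sum>j<k. (real (card (C j)) - real n / real k)\<^sup>2)
        = (\<Sum>j<k. (real (card (C j)))\<^sup>2 - 2 * (real n / real k) * real (card (C j)) + (real n / real k)\<^sup>2)"
      by (intro sum.cong refl) (simp add: power2_diff)
    also have "\<dots> = Q - 2 * (real n / real k) * real n + real k * (real n / real k)\<^sup>2"
      by (simp only: sum.distrib sum_subtractf sum_distrib_left[symmetric] sumC Q_eq) simp
    also have "\<dots> = Q - (real n)\<^sup>2 / real k" using k by (simp add: power2_eq_square field_simps)
    finally show ?thesis .
  qed
  then have Q_ge: "(real n)\<^sup>2 / real k \<le> Q"
    using sum_nonneg[of "{..<k}" "\<lambda>j. (real (card (C j)) - real n / real k)\<^sup>2"] by simp
  have nk: "(1 - 1 / real k) * (real n)\<^sup>2 = (real n)\<^sup>2 - (real n)\<^sup>2 / real k" by (simp add: algebra_simps)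
  have Q_le: "Q - (real n)\<^sup>2 / real k \<le> (r * real n)\<^sup>2" using TSQ T S0 KL nk by linarith
  have S_le: "S \<le> (r * real n)\<^sup>2" using TSQ T Q_ge KL nk by linarith
  have part_ge: "real n / real k - r * real n \<le> real (card (C j))" if "j < k" for j
  proof -
    have "(real (card (C j)) - real n / real k)\<^sup>2 \<le> (\<Sum>j<k. (real (card (C j)) - real n / real k)\<^sup>2)"
      using that by (intro member_le_sum) auto
    with var Q_le have "(real (card (C j)) - real n / real k)\<^sup>2 \<le> (r * real n)\<^sup>2" by linarith
    then have "\<bar>real (card (C j)) - real n / real k\<bar> \<le> r * real n" using r by (simp add: abs_le_square_iff[symmetric])
    then show ?thesis by linarith
  qed
  \<comment> \<open>\<open>r * n\<close> covers the deficit of a class and 1 the rounding in a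
    residue class; the ceiling costs at most one more.\<close>
  define z where "z = nat \<lceil>r * real n + 1\<rceil>"
  have rn: "0 \<le> r * real n" using r by simp
  have z: "r * real n + 1 \<le> real z" "real z \<le> r * real n + 2" using rn unfolding z_def by linarith+
  have "card {v. v < n \<and> v mod k = j} \<le> card (C j) + z" if "j < k" for j
  proof -
    have "real (card {v. v < n \<and> v mod k = j}) \<le> real (card (C j)) + real z"
      using card_residue_class_le[OF k, of n j] part_ge[OF that] z by linarith
    then show ?thesis by linarith
  qed
  then obtain \<pi> where \<pi>: "bij_betw \<pi> {..<n} {..<n}" "card {v. v < n \<and> c (\<pi> v) \<noteq> v mod k} \<le> k * z"
    using bij_matching_classes[of n "\<lambda>v. v mod k" k c z] c k by (auto simp: C_def)
  define M where "M = {v. v < n \<and> c (\<pi> v) \<noteq> v mod k}"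
  \<comment> \<open>The pairs on which \<open>E\<close> differs from the complete multipartite graph
    of \<open>c\<close>, counted below by inclusion-exclusion.\<close>
  define BP where "BP = {(u, v). u < n \<and> v < n \<and> (v \<in> nbrs E u \<longleftrightarrow> c u = c v)}"
  have BPsub: "BP \<subseteq> {..<n} \<times> {..<n}" by (auto simp: BP_def)
  then have finBP: "finite BP" by (rule finite_subset) simp
  have "real (card BP) = (\<Sum>u<n. \<Sum>v<n. of_bool (v \<in> nbrs E u \<longleftrightarrow> c u = c v))"
  proof -
    have "BP = (SIGMA u:{..<n}. {v \<in> {..<n}. v \<in> nbrs E u \<longleftrightarrow> c u = c v})" by (auto simp: BP_def)
    then have "card BP = (\<Sum>u<n. card {v \<in> {..<n}. v \<in> nbrs E u \<longleftrightarrow> c u = c v})" by simp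
    then show ?thesis by (simp add: of_bool_def flip: sum.inter_filter)
  qed
  also have "\<dots> = (\<Sum>u<n. \<Sum>v<n. 1 - of_bool (c u = c v) - of_bool (v \<in> nbrs E u) + 2 * of_bool (v \<in> nbrs E u \<and> c u = c v))"
    by (intro sum.cong refl) auto
  also have "\<dots> = (real n)\<^sup>2 - Q - T + 2 * S"
    unfolding Q_def T_def S_def
    by (simp only: sum.distrib sum_subtractf sum_distrib_left[symmetric]) (simp add: power2_eq_square)
  also have "\<dots> \<le> 3 * (r * real n)\<^sup>2" using Q_ge T S_le KL nk by linarith
  finally have cBP: "real (card BP) \<le> 3 * (r * real n)\<^sup>2" .
  define pr :: "nat \<times> nat \<Rightarrow> nat set" where "pr p = {fst p, snd p}" for p
  \<comment> \<open>Besides \<open>BP\<close>, all pairs at a vertex whose colour does not match its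
    Turan part are given up. Ordered pairs only overcount edges.\<close>
  define X where "X = BP \<union> (\<pi> ` M) \<times> {..<n}"
  have finX: "finite X" using finBP by (simp add: X_def M_def)
  have key: "{\<pi> i, \<pi> j} \<in> pr ` X"
    if ij: "i < n" "j < n" and "(\<pi> j \<in> nbrs E (\<pi> i)) \<noteq> (i mod k \<noteq> j mod k)" for i j
  proof -
    have lt: "\<pi> i < n" "\<pi> j < n" using \<pi>(1) ij by (auto simp: bij_betw_def)
    consider "i \<in> M" | "j \<in> M" | "i \<notin> M" "j \<notin> M" by blast
    then show ?thesis
    proof cases
      case 1
      then have "(\<pi> i, \<pi> j) \<in> X" using lt by (simp add: X_def)
      then show ?thesis by (rule rev_image_eqI) (simp add: pr_def)
    next
      case 2
      then have "(\<pi> j, \<pi> i) \<in> X" using lt by (simp add: X_def)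
      then show ?thesis by (rule rev_image_eqI) (simp add: pr_def insert_commute)
    next
      case 3
      then have "c (\<pi> i) = i mod k" "c (\<pi> j) = j mod k" using ij by (auto simp: M_def)
      then have "(\<pi> i, \<pi> j) \<in> X" using lt that(3) by (simp add: X_def BP_def)
      then show ?thesis by (rule rev_image_eqI) (simp add: pr_def)
    qed
  qed
  let ?TT = "(\<lambda>e. \<pi> ` e) ` turan_edges n k"
  have "(E - ?TT) \<union> (?TT - E) \<subseteq> pr ` X"
  proof
    fix e assume "e \<in> (E - ?TT) \<union> (?TT - E)"
    then show "e \<in> pr ` X"
    proof (elim UnE DiffE)
      assume 1: "e \<in> E" "e \<notin> ?TT"
      from 1(1) obtain a b where ab: "e = {a, b}" "a < n" "b < n" using E unfolding simple_graph_def by blast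
      have "\<pi> ` {..<n} = {..<n}" using \<pi>(1) by (simp add: bij_betw_def)
      with ab(2,3) have "a \<in> \<pi> ` {..<n}" "b \<in> \<pi> ` {..<n}" by simp_all
      then obtain i j where ij: "i < n" "j < n" "a = \<pi> i" "b = \<pi> j" by (elim imageE) simp
      have "\<pi> ` {i, j} = e" by (simp add: ab(1) ij)
      with 1(2) have "{i, j} \<notin> turan_edges n k" by blast
      then have "i mod k = j mod k" using ij unfolding turan_edges_def by blast
      moreover have "\<pi> j \<in> nbrs E (\<pi> i)" using 1(1) ab ij by (simp add: nbrs_def insert_commute)
      ultimately have "{\<pi> i, \<pi> j} \<in> pr ` X" using key[OF ij(1,2)] by blast
      then show ?thesis by (simp only: ab(1) ij)
    next
      assume 2: "e \<in> ?TT" "e \<notin> E"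
      from 2(1) obtain i j where ij: "i < n" "j < n" "i mod k \<noteq> j mod k" "e = \<pi> ` {i, j}"
        unfolding turan_edges_def by blast
      then have "{\<pi> j, \<pi> i} \<notin> E" using 2(2) by (simp add: insert_commute)
      then have "\<pi> j \<notin> nbrs E (\<pi> i)" by (simp add: nbrs_def)
      then have "{\<pi> i, \<pi> j} \<in> pr ` X" using key[OF ij(1,2)] ij(3) by blast
      then show ?thesis by (simp add: ij(4))
    qed
  qed
  then have "card ((E - ?TT) \<union> (?TT - E)) \<le> card (pr ` X)"
    by (rule card_mono[OF finite_imageI[OF finX]])
  also have "\<dots> \<le> card X" using finX by (rule card_image_le)
  also have "\<dots> \<le> card BP + card ((\<pi> ` M) \<times> {..<n})" unfolding X_def by (rule card_Un_le)
  also have "card ((\<pi> ` M) \<times> {..<n}) \<le> (k * z) * n"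
  proof -
    have "card (\<pi> ` M) \<le> card M" by (rule card_image_le) (simp add: M_def)
    also have "\<dots> \<le> k * z" unfolding M_def by (rule \<pi>(2))
    finally show ?thesis by (simp add: card_cartesian_product)
  qed
  finally have "real (card ((E - ?TT) \<union> (?TT - E))) \<le> real (card BP + (k * z) * n)"
    by (simp only: of_nat_le_iff)
  also have "\<dots> = real (card BP) + real k * real z * real n" by simp
  also have "\<dots> \<le> 3 * (r * real n)\<^sup>2 + real k * (r * real n + 2) * real n"
    using cBP z by (intro add_mono mult_right_mono mult_left_mono) auto
  finally show ?thesis unfolding close_to_turan_def by (intro exI[of _ \<pi>] conjI \<pi>(1))
qed

section \<open>Choice of the constants and conclusion\<close>

theorem theorem2p13:
  fixes k m :: nat and EF :: "nat set set"
  assumes "k \<ge> 3"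
    and "simple_graph m EF"
    and "chromatic_number m EF = k + 1"
  shows "\<forall>\<epsilon>::real. \<epsilon> > 0 \<longrightarrow>
    (\<exists>\<sigma>::real. \<sigma> > 0 \<and> (\<exists>n0::nat. \<forall>n E. n \<ge> n0 \<and> simple_graph n E \<and> F_free n E m EF \<and>
        q_index n E \<ge> 2 * (1 - 1 / real k - \<sigma>) * real n
        \<longrightarrow> close_to_turan n k E (\<epsilon> * real n ^ 2)))"
proof (intro allI impI)
  fix \<epsilon> :: real
  assume \<epsilon>: "\<epsilon> > 0"
  have kr: "real k \<ge> 3" using assms(1) by simp
  obtain \<kappa> where \<kappa>: "proper_colouring m EF (k + 1) \<kappa>"
    using chromatic_number_colouring[OF assms(2)] assms(3) by metis
  \<comment> \<open>The graph without vertices is coloured with 0 colours.\<close>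
  have "m > 0"
  proof (rule ccontr)
    assume "\<not> m > 0"
    then have "proper_colouring m EF 0 \<kappa>"
      using assms(2) by (auto simp: proper_colouring_def dest: simple_graphD)
    then have "chromatic_number m EF \<le> 0" unfolding chromatic_number_def by (intro Least_le) blast
    with assms(3) show False by simp
  qed
  \<comment> \<open>The final error is \<open>3 * r\<^sup>2 + k * r \<le> (k + 3) * r\<close> times
    \<open>n\<^sup>2\<close>, which gets half of \<open>\<epsilon>\<close>, plus
    \<open>2 * k * n\<close>, which gets the other half for large \<open>n\<close>.\<close>
  define r where "r = min 1 (\<epsilon> / (2 * (real k + 3)))"
  have r: "0 < r" "r \<le> 1" using \<epsilon> kr by (auto simp: r_def)
  have "(real k + 3) * r \<le> (real k + 3) * (\<epsilon> / (2 * (real k + 3)))"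
    using kr by (intro mult_left_mono) (auto simp: r_def)
  also have "\<dots> = \<epsilon> / 2" using kr by (simp add: field_simps)
  finally have kr_le: "(real k + 3) * r \<le> \<epsilon> / 2" .
  \<comment> \<open>The loss \<open>13 * s\<close> in the degree sum takes half of
    \<open>r\<^sup>2\<close>; the other half covers the colouring error
    \<open>s\<^sup>2 / 18\<close>.\<close>
  define s where "s = r\<^sup>2 / 26"
  have s: "0 < s" "s \<le> 1" using r power_le_one[of r 2] by (auto simp: s_def)
  define e where "e = s\<^sup>2 / (18 * real k)"
  have e: "18 * real k * e = s\<^sup>2" "0 < e" using kr s by (auto simp: e_def)
  have "0 < (e / 48) ^ (k + 1)" using e(2) by simp
  from F_free_few_cliques[OF this \<open>m > 0\<close> assms(2) \<kappa>]
  obtain n1 where n1: "\<forall>n\<ge>n1. \<forall>E. simple_graph n E \<and> F_free n E m EF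
      \<longrightarrow> real (card (cliques E {..<n} (k + 1))) < (e / 48) ^ (k + 1) * real n ^ (k + 1)" ..
  define n0 where "n0 = max n1 (nat \<lceil>48 / e\<rceil> + nat \<lceil>4 * real k / \<epsilon>\<rceil> + 1)"
  have "close_to_turan n k E (\<epsilon> * real n ^ 2)"
    if n: "n \<ge> n0" and E: "simple_graph n E" and F: "F_free n E m EF"
      and q: "q_index n E \<ge> 2 * (1 - 1 / real k - e / 4) * real n" for n E
  proof -
    have n_ge: "n \<ge> n1" "real n \<ge> 48 / e" "real n \<ge> 4 * real k / \<epsilon>" "n > 0"
      using n unfolding n0_def by linarith+
    \<comment> \<open>\<open>h ^ (k + 1)\<close> must exceed the number of cliques, while
      \<open>h / n\<close> must stay an admissible error; \<open>n \<ge> 48 / e\<close> lets the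
      ceiling cost at most a factor 2.\<close>
    define h where "h = nat \<lceil>e / 48 * real n\<rceil>"
    have en: "1 \<le> e / 48 * real n" using n_ge(2) e by (simp add: field_simps)
    have h: "e / 48 * real n \<le> real h" "real h \<le> e / 24 * real n" "h > 0"
    proof -
      show "e / 48 * real n \<le> real h" unfolding h_def by linarith
      then show "h > 0" using en by linarith
      have "real h \<le> e / 48 * real n + 1" unfolding h_def using en by linarith
      then show "real h \<le> e / 24 * real n" using en by linarith
    qed
    have "real (card (cliques E {..<n} (k + 1))) < (e / 48 * real n) ^ (k + 1)"
      using n1[rule_format, of n E] n_ge E F by (simp only: power_mult_distrib)
    also have "\<dots> \<le> real h ^ (k + 1)" using h(1) en by (intro power_mono) auto
    finally have "card (cliques E {..<n} (k + 1)) < h ^ (k + 1)" by (simp only: of_nat_less_iff flip: of_nat_power)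
    \<comment> \<open>The clique count does not involve the score, so one bound yields runs with at
      most \<open>k\<close> parts for both scores.\<close>
    then have greedy: "\<exists>ps. greedy E f h {..<n} ps \<and> length ps < k + 1" for f
      using greedy_or_many_cliques[of "{..<n}" h "k + 1" E f] h(3) by auto
    obtain x where x: "\<And>v. 0 \<le> x v" "\<exists>v<n. x v \<noteq> 0"
      "\<And>v. v < n \<Longrightarrow> 2 * (1 - 1 / real k - e / 4) * real n * x v \<le> real (degree E v) * x v + (\<Sum>u\<in>nbrs E v. x u)"
      using q_index_subeigenvector[OF E n_ge(4) q] by blast
    obtain ps where "greedy E (\<lambda>_. x) h {..<n} ps" "length ps < k + 1" using greedy by blast
    then have deg: "(1 - 1 / real k - 13 * s) * (real n)\<^sup>2 \<le> (\<Sum>v<n. real (degree E v))"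
      using spectral_degree_sum[OF assms(1) E n_ge(4) s e(1) x _ _ h(2), of ps] by simp
    obtain ps' where ps': "greedy E (\<lambda>A v. real (card (A \<inter> nbrs E v))) h {..<n} ps'" "length ps' < k + 1"
      using greedy by blast
    obtain c where c: "\<forall>v. c v < max 1 (length ps')"
      "(\<Sum>u<n. \<Sum>v<n. pair_weight E c u v) \<le> (card {..<n})\<^sup>2 + (6 * length ps' + 2) * (h * n)"
      using greedy_colouring[OF ps'(1), of n] by auto
    have ck: "c v < k" for v using c(1)[rule_format, of v] ps'(2) assms(1) by linarith
    have "(\<Sum>u<n. \<Sum>v<n. pair_weight E c u v) \<le> n\<^sup>2 + (6 * length ps' + 2) * (h * n)" using c(2) by simp
    \<comment> \<open>The factor 24 is rounded up from \<open>6 * k + 2\<close> to cancel the 24 in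
      the bound on \<open>h\<close>, leaving \<open>k * e = s\<^sup>2 / 18\<close>.\<close>
    also have "\<dots> \<le> n\<^sup>2 + (24 * k) * (h * n)"
      using ps'(2) assms(1) by (intro add_mono mult_right_mono) auto
    finally have "real (\<Sum>u<n. \<Sum>v<n. pair_weight E c u v) \<le> real (n\<^sup>2 + (24 * k) * (h * n))"
      by (simp only: of_nat_le_iff)
    also have "\<dots> = (real n)\<^sup>2 + 24 * real k * (real h * real n)" by simp
    also have "24 * real k * (real h * real n) \<le> 24 * real k * ((e / 24 * real n) * real n)"
      using h(2) by (intro mult_left_mono mult_right_mono) auto
    also have "\<dots> = s\<^sup>2 / 18 * (real n)\<^sup>2" using e(1) by (simp add: power2_eq_square field_simps)
    finally have W: "real (\<Sum>u<n. \<Sum>v<n. pair_weight E c u v) \<le> (real n)\<^sup>2 + s\<^sup>2 / 18 * (real n)\<^sup>2" by simp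
    have "s\<^sup>2 / 18 + 13 * s \<le> r\<^sup>2"
    proof -
      have "s\<^sup>2 \<le> s" using s by (simp add: power2_eq_square mult_left_le)
      moreover have "26 * s = r\<^sup>2" by (simp add: s_def)
      ultimately show ?thesis using s by (simp add: field_simps)
    qed
    then have KL: "s\<^sup>2 / 18 * (real n)\<^sup>2 + 13 * s * (real n)\<^sup>2 \<le> (r * real n)\<^sup>2"
      unfolding power_mult_distrib distrib_right[symmetric] by (rule mult_right_mono) simp
    have "close_to_turan n k E (3 * (r * real n)\<^sup>2 + real k * (r * real n + 2) * real n)"
      using deg s r kr ck
      by (intro close_to_turan_if_colouring[OF E _ _ _ _ _ KL W]) (auto simp: algebra_simps)
    moreover have "3 * (r * real n)\<^sup>2 + real k * (r * real n + 2) * real n \<le> \<epsilon> * real n ^ 2"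
    proof -
      have "r\<^sup>2 \<le> r" using r by (simp add: power2_eq_square mult_left_le)
      then have "3 * r\<^sup>2 + real k * r \<le> \<epsilon> / 2" using kr_le by (simp add: algebra_simps)
      then have "(3 * r\<^sup>2 + real k * r) * (real n)\<^sup>2 \<le> \<epsilon> / 2 * (real n)\<^sup>2" by (rule mult_right_mono) simp
      moreover have "4 * real k \<le> \<epsilon> * real n" using n_ge(3) \<epsilon> by (simp add: field_simps)
      then have "2 * real k * real n \<le> \<epsilon> / 2 * (real n)\<^sup>2"
        using mult_right_mono[of "4 * real k" "\<epsilon> * real n" "real n"] by (simp add: power2_eq_square)
      ultimately show ?thesis by (simp add: algebra_simps power2_eq_square)
    qed
    ultimately show ?thesis unfolding close_to_turan_def using order_trans by blast
  qed
  then show "\<exists>\<sigma>::real. \<sigma> > 0 \<and> (\<exists>n0::nat. \<forall>n E. n \<ge> n0 \<and> simple_graph n E \<and> F_free n E m EF \<and>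
        q_index n E \<ge> 2 * (1 - 1 / real k - \<sigma>) * real n
        \<longrightarrow> close_to_turan n k E (\<epsilon> * real n ^ 2))"
    using e(2) by (intro exI[of _ "e / 4"] conjI exI[of _ n0]) auto
qed

end
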